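(* Let $\Pi$ be a non-negative g-convex function on the set of real symmetric positive definite matrices of order $q$, and let $S_n$ be the sample covariance matrix of a sample in $\mathbb{R}^q$, with $S_n>0$. Then for every $\eta\ge 0$ there exists a unique critical point $\widehat\Sigma_\eta>0$ of $L(\Sigma;S_n,\eta)$ over $\Sigma>0$, and $\widehat\Sigma_\eta$ is the unique minimizer of $L(\Sigma;S_n,\eta)$ over $\Sigma>0$. Furthermore, $\widehat\Sigma_\eta$ is a continuous function of $\eta\ge 0$.
   Context: $\Sigma>0$ means $\Sigma$ is a real symmetric positive definite matrix of order $q$. For a sample $x_1,\ldots,x_n\in\mathbb{R}^q$, the sample covariance matrix is $S_n=n^{-1}\sum_{i=1}^n(x_i-\bar x)(x_i-\bar x)^{\mathrm T}$. The penalized loss function is $L(\Sigma;S_n,\eta)=\mathrm{tr}(\Sigma^{-1}S_n)+\log\det\Sigma+\eta\,\Pi(\Sigma)$. The geodesic path from $\Sigma_0>0$ to $\Sigma_1>0$ is $\Sigma_t=\Sigma_0^{1/2}\{\Sigma_0^{-1/2}\Sigma_1\Sigma_0^{-1/2}\}^t\Sigma_0^{1/2}$, $0\le t\le 1$. A real-valued function $F$ on $\Sigma>0$ is g-convex if $F(\Sigma_t)\le(1-t)F(\Sigma_0)+tF(\Sigma_1)$ for all $\Sigma_0,\Sigma_1>0$ and $0<t<1$. A critical point of a g-convex function $F$ is a point $\Sigma_0>0$ such that, for every $\Sigma_1>0$, the one-sided derivative of $t\mapsto F(\Sigma_t)$ at $t=0^+$ along the geodesic from $\Sigma_0$ to $\Sigma_1$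 is non-negative; when $F$ is differentiable this means that the gradient of $F$ vanishes at $\Sigma_0$. *)

theory Defs
  imports "HOL-Analysis.Analysis"
begin

definition pos_def :: "real^'q^'q \<Rightarrow> bool" where
  "pos_def A \<longleftrightarrow> transpose A = A \<and> (\<forall>v. v \<noteq> 0 \<longrightarrow> v \<bullet> (A *v v) > 0)"

definition diag_matrix :: "real^'q \<Rightarrow> real^'q^'q" where
  "diag_matrix d = (\<chi> i j. if i = j then d $ i else 0)"

text \<open>Real powers of a positive definite matrix through a spectral decomposition
  \<open>A = P diag(d) P\<^sup>T\<close>. The result does not depend on the decomposition chosen
  (lemma \<open>mpow_unique\<close> below).\<close>

definition is_mpow :: "real^'q^'q \<Rightarrow> real \<Rightarrow> real^'q^'q \<Rightarrow> bool" where
  "is_mpow A t B \<longleftrightarrow> (\<exists>P d. orthogonal_matrix P \<and>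
     A = P ** diag_matrix d ** transpose P \<and>
     B = P ** diag_matrix (\<chi> i. (d $ i) powr t) ** transpose P)"

definition mpow :: "real^'q^'q \<Rightarrow> real \<Rightarrow> real^'q^'q" where
  "mpow A t = (THE B. is_mpow A t B)"

lemma mpow_unique:
  fixes A B C :: "real^'q^'q"
  assumes "is_mpow A t B" and "is_mpow A t C"
  shows "B = C"
proof -
  obtain P d where P: "orthogonal_matrix P" and A1: "A = P ** diag_matrix d ** transpose P"
    and B: "B = P ** diag_matrix (\<chi> i. (d $ i) powr t) ** transpose P"
    using assms(1) unfolding is_mpow_def by blast
  obtain Q e where Q: "orthogonal_matrix Q" and A2: "A = Q ** diag_matrix e ** transpose Q"
    and C: "C = Q ** diag_matrix (\<chi> i. (e $ i) powr t) ** transpose Q"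
    using assms(2) unfolding is_mpow_def by blast
  have PP: "transpose P ** P = mat 1" "P ** transpose P = mat 1"
    and QQ: "transpose Q ** Q = mat 1" "Q ** transpose Q = mat 1"
    using P Q unfolding orthogonal_matrix_def by auto
  define U where "U = transpose Q ** P"
  have dr: "(U ** diag_matrix a) $ i $ j = U $ i $ j * a $ j" for a :: "real^'q" and i j
    unfolding matrix_matrix_mult_def diag_matrix_def
    by (simp add: if_distrib[of "\<lambda>x. _ * x"] cong: if_cong)
  have dl: "(diag_matrix a ** U) $ i $ j = a $ i * U $ i $ j" for a :: "real^'q" and i j
    unfolding matrix_matrix_mult_def diag_matrix_def
    by (simp add: if_distrib[of "\<lambda>x. x * _"] cong: if_cong)
  have "transpose Q ** A ** P = U ** diag_matrix d"
    by (simp add: A1 U_def matrix_mul_assoc[symmetric] PP)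
  moreover have "transpose Q ** A ** P = diag_matrix e ** U"
    by (simp add: A2 U_def matrix_mul_assoc QQ)
  ultimately have "U $ i $ j * d $ j = e $ i * U $ i $ j" for i j
    by (metis (no_types) dr dl)
  then have "U $ i $ j = 0 \<or> d $ j = e $ i" for i j
    by (simp add: mult.commute[of "e $ i"])
  then have "U $ i $ j * (d $ j) powr t = (e $ i) powr t * U $ i $ j" for i j
    by (metis (no_types) mult.commute mult_zero_left)
  then have eq: "U ** diag_matrix (\<chi> i. (d $ i) powr t) = diag_matrix (\<chi> i. (e $ i) powr t) ** U"
    by (simp add: vec_eq_iff dr dl)
  have "B = Q ** (U ** diag_matrix (\<chi> i. (d $ i) powr t)) ** transpose P"
    by (simp add: B U_def matrix_mul_assoc QQ)
  also have "\<dots> = C"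
    unfolding eq by (simp add: C U_def matrix_mul_assoc[symmetric] PP)
  finally show ?thesis .
qed

definition geodesic :: "real^'q^'q \<Rightarrow> real^'q^'q \<Rightarrow> real \<Rightarrow> real^'q^'q" where
  "geodesic \<Sigma>\<^sub>0 \<Sigma>\<^sub>1 t =
     mpow \<Sigma>\<^sub>0 (1/2) ** mpow (mpow \<Sigma>\<^sub>0 (-1/2) ** \<Sigma>\<^sub>1 ** mpow \<Sigma>\<^sub>0 (-1/2)) t ** mpow \<Sigma>\<^sub>0 (1/2)"

text \<open>Functions on the positive definite matrices are represented by functions on all
  matrices; the notions below only use their values on positive definite arguments.\<close>

definition g_convex :: "(real^'q^'q \<Rightarrow> real) \<Rightarrow> bool" where
  "g_convex F \<longleftrightarrow> (\<forall>\<Sigma>\<^sub>0 \<Sigma>\<^sub>1 t. pos_def \<Sigma>\<^sub>0 \<longrightarrow> pos_def \<Sigma>\<^sub>1 \<longrightarrow> 0 < t \<longrightarrow> t < 1 \<longrightarrow>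
     F (geodesic \<Sigma>\<^sub>0 \<Sigma>\<^sub>1 t) \<le> (1 - t) * F \<Sigma>\<^sub>0 + t * F \<Sigma>\<^sub>1)"

definition critical_point :: "(real^'q^'q \<Rightarrow> real) \<Rightarrow> real^'q^'q \<Rightarrow> bool" where
  "critical_point F \<Sigma>\<^sub>0 \<longleftrightarrow> pos_def \<Sigma>\<^sub>0 \<and>
     (\<forall>\<Sigma>\<^sub>1. pos_def \<Sigma>\<^sub>1 \<longrightarrow>
       (\<exists>D\<ge>0. ((\<lambda>t. F (geodesic \<Sigma>\<^sub>0 \<Sigma>\<^sub>1 t)) has_real_derivative D) (at_right 0)))"

definition minimizer :: "(real^'q^'q \<Rightarrow> real) \<Rightarrow> real^'q^'q \<Rightarrow> bool" where
  "minimizer F \<Sigma>\<^sub>0 \<longleftrightarrow> pos_def \<Sigma>\<^sub>0 \<and> (\<forall>\<Sigma>. pos_def \<Sigma> \<longrightarrow> F \<Sigma>\<^sub>0 \<le> F \<Sigma>)"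

definition sample_mean :: "nat \<Rightarrow> (nat \<Rightarrow> real^'q) \<Rightarrow> real^'q" where
  "sample_mean n x = (1 / real n) *\<^sub>R (\<Sum>i = 1..n. x i)"

definition outer :: "real^'q \<Rightarrow> real^'q \<Rightarrow> real^'q^'q" where
  "outer v w = (\<chi> i j. v $ i * w $ j)"

definition sample_cov :: "nat \<Rightarrow> (nat \<Rightarrow> real^'q) \<Rightarrow> real^'q^'q" where
  "sample_cov n x =
     (1 / real n) *\<^sub>R (\<Sum>i = 1..n. outer (x i - sample_mean n x) (x i - sample_mean n x))"

definition penalized_loss ::
    "(real^'q^'q \<Rightarrow> real) \<Rightarrow> real^'q^'q \<Rightarrow> real \<Rightarrow> real^'q^'q \<Rightarrow> real" where
  "penalized_loss pen S \<eta> \<Sigma> = trace (matrix_inv \<Sigma> ** S) + ln (det \<Sigma>) + \<eta> * pen \<Sigma>"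

end

theory Submission
  imports Defs
begin

text \<open>
  Write \<open>g(\<Sigma>) = tr(\<Sigma>\<inverse>S) + log det \<Sigma>\<close>, so that the loss is \<open>g + \<eta> pen\<close>. The proof is convex
  analysis along geodesics, with three inputs.

  \<^item> Two positive definite matrices are diagonalized simultaneously by a congruence, \<open>A = TT\<^sup>T\<close> and
    \<open>B = T diag(d) T\<^sup>T\<close>, and then the geodesic from \<open>A\<close> to \<open>B\<close> is \<open>T diag(d\<^sup>t) T\<^sup>T\<close>
    (\<open>geodesic_congr_diag\<close>, \<open>pos_def_simultaneous_diagonalization\<close>). In these coordinates \<open>g\<close> is, up
    to a constant, \<open>\<Sum>\<^sub>i c\<^sub>i d\<^sub>i\<^sup>-\<^sup>t + t log d\<^sub>i\<close> with all \<open>c\<^sub>i > 0\<close>, hence strictly convex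
    (\<open>gauss_loss_strictly_g_convex\<close>).

  \<^item> Sublevel sets of \<open>g\<close> lie in compact sets of positive definite matrices
    (\<open>gauss_loss_coercive\<close>): in terms of the eigenvalues \<open>d\<^sub>i\<close> of \<open>\<Sigma>\<close>, the function \<open>g\<close> is at least
    \<open>\<Sum>\<^sub>i l/d\<^sub>i + log d\<^sub>i\<close>, where \<open>l > 0\<close> is a lower bound of the quadratic form of \<open>S\<close> on unit
    vectors. As \<open>pen \<ge> 0\<close>, the same holds for the loss.

  \<^item> Every g-convex function is continuous (\<open>g_convex_continuous_on\<close>). The key is that the straight
    line \<open>X + s vv\<^sup>T\<close> is itself a geodesic up to its parametrization (\<open>rank_one_geodesic\<close>), and that
    the matrices \<open>vv\<^sup>T\<close> span the symmetric matrices. So a g-convex function is, in suitable linear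
    coordinates, convex in each coordinate separately after a reparametrization. This bounds it on a
    small cube by its values at the corners, and upper bounds of a convex function on a line control
    its oscillation.

  Continuity and coercivity give a minimizer, strict convexity makes it unique. For a g-convex
  function, critical points and minimizers coincide, because difference quotients along a geodesic
  are monotone. Finally, for \<open>\<eta> \<le> E\<close> all minimizers lie in one compact set, and the graph of the
  minimizer is closed there, because it is cut out by the inequalities \<open>L(\<Sigma>; \<eta>) \<le> L(B; \<eta>)\<close> between
  functions continuous in \<open>(\<eta>, \<Sigma>)\<close>; so the minimizer depends continuously on \<open>\<eta>\<close>.
\<close>

section \<open>Matrices congruent to a diagonal matrix\<close>

definition congr_diag :: "real^'q^'q \<Rightarrow> real^'q \<Rightarrow> real^'q^'q" where
  "congr_diag T d = T ** diag_matrix d ** transpose T"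

lemma diag_matrix_mult: "diag_matrix a ** diag_matrix b = diag_matrix (\<chi> i. a $ i * b $ i)"
  by (simp add: vec_eq_iff matrix_matrix_mult_def diag_matrix_def if_distrib[of "\<lambda>x. x * _"] cong: if_cong)

lemma transpose_diag_matrix [simp]: "transpose (diag_matrix d) = diag_matrix d"
  by (auto simp: vec_eq_iff transpose_def diag_matrix_def)

lemma diag_matrix_one: "diag_matrix (\<chi> i. 1) = mat 1"
  by (simp add: vec_eq_iff diag_matrix_def mat_def)

lemma diag_matrix_vector: "(diag_matrix d *v x) $ i = d $ i * x $ i"
  by (simp add: matrix_vector_mult_def diag_matrix_def if_distrib[of "\<lambda>x. x * _"] cong: if_cong)

lemma det_diag_matrix: "det (diag_matrix d) = (\<Prod>i\<in>UNIV. d $ i)"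
  by (subst det_diagonal) (auto simp: diag_matrix_def)

lemma transpose_congr_diag [simp]: "transpose (congr_diag T d) = congr_diag T d"
  by (simp add: congr_diag_def matrix_transpose_mul matrix_mul_assoc)

lemma congr_diag_one: "congr_diag T (\<chi> i. 1) = T ** transpose T"
  by (simp add: congr_diag_def diag_matrix_one)

lemma congr_diag_left: "X ** congr_diag T d ** transpose X = congr_diag (X ** T) d"
  by (simp add: congr_diag_def matrix_transpose_mul matrix_mul_assoc)

lemma congr_diag_orthogonal_mult:
  assumes "orthogonal_matrix P"
  shows "congr_diag P a ** congr_diag P b = congr_diag P (\<chi> i. a $ i * b $ i)"
proof -
  have "congr_diag P a ** congr_diag P b =
      P ** diag_matrix a ** (transpose P ** P) ** diag_matrix b ** transpose P"
    by (simp add: congr_diag_def matrix_mul_assoc)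
  also have "\<dots> = P ** (diag_matrix a ** diag_matrix b) ** transpose P"
    using assms by (simp add: orthogonal_matrix_def matrix_mul_assoc)
  finally show ?thesis by (simp add: diag_matrix_mult congr_diag_def)
qed

lemma congr_diag_quadratic_form:
  "v \<bullet> (congr_diag T d *v v) = (\<Sum>i\<in>UNIV. d $ i * ((v v* T) $ i)\<^sup>2)"
proof -
  have "v \<bullet> (congr_diag T d *v v) = (v v* T) \<bullet> (diag_matrix d *v (v v* T))"
    by (simp add: congr_diag_def matrix_vector_mul_assoc[symmetric] dot_lmul_matrix)
  then show ?thesis
    by (simp add: inner_vec_def diag_matrix_vector power2_eq_square algebra_simps)
qed

lemma pos_def_congruence:
  fixes T :: "real^'q^'q"
  assumes "pos_def A" "invertible T"
  shows "pos_def (T ** A ** transpose T)"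
  unfolding pos_def_def
proof (intro conjI allI impI)
  show "transpose (T ** A ** transpose T) = T ** A ** transpose T"
    using assms(1) by (simp add: pos_def_def matrix_transpose_mul matrix_mul_assoc)
  fix v :: "real^'q" assume "v \<noteq> 0"
  obtain X where X: "T ** X = mat 1" using assms(2) by (auto simp: invertible_def)
  have "v v* T \<noteq> 0"
  proof
    assume "v v* T = 0"
    then have "(v v* T) v* X = 0" by simp
    then have "v v* (T ** X) = 0" by (simp add: vector_matrix_mul_assoc)
    with \<open>v \<noteq> 0\<close> show False by (simp add: X)
  qed
  then have "(v v* T) \<bullet> (A *v (v v* T)) > 0" using assms(1) by (auto simp: pos_def_def)
  then show "v \<bullet> (T ** A ** transpose T *v v) > 0"
    by (simp add: matrix_vector_mul_assoc[symmetric] dot_lmul_matrix)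
qed

lemma pos_def_diag_matrix: "pos_def (diag_matrix d) \<longleftrightarrow> (\<forall>i. d $ i > 0)"
proof
  assume *: "pos_def (diag_matrix d)"
  show "\<forall>i. d $ i > 0"
  proof
    fix i
    have "axis i 1 \<bullet> (diag_matrix d *v axis i 1) > 0"
      using * by (simp add: pos_def_def axis_eq_0_iff)
    then show "d $ i > 0" by (simp add: inner_axis' diag_matrix_vector)
  qed
next
  assume *: "\<forall>i. d $ i > 0"
  show "pos_def (diag_matrix d)"
    unfolding pos_def_def
  proof (intro conjI allI impI)
    fix v :: "real^'a" assume "v \<noteq> 0"
    then obtain i where i: "v $ i \<noteq> 0" by (auto simp: vec_eq_iff)
    have "(\<Sum>i\<in>UNIV. d $ i * (v $ i)\<^sup>2) > 0"
      using * i by (intro sum_pos2[of _ i]) (auto simp: less_imp_le)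
    then show "v \<bullet> (diag_matrix d *v v) > 0"
      by (simp add: inner_vec_def diag_matrix_vector power2_eq_square algebra_simps)
  qed simp
qed

text \<open>Sylvester's law of inertia in the definite case: a congruence can be undone by the inverse
congruence.\<close>

lemma pos_def_congr_diag:
  fixes T :: "real^'q^'q"
  assumes T: "invertible T"
  shows "pos_def (congr_diag T d) \<longleftrightarrow> (\<forall>i. d $ i > 0)"
proof
  obtain X where X: "T ** X = mat 1" "X ** T = mat 1" using T by (auto simp: invertible_def)
  assume "pos_def (congr_diag T d)"
  moreover have "invertible X" using X by (auto simp: invertible_def)
  ultimately have "pos_def (X ** congr_diag T d ** transpose X)" by (rule pos_def_congruence)
  then have "pos_def (congr_diag (mat 1) d)" by (simp add: congr_diag_left X)
  then show "\<forall>i. d $ i > 0" by (simp add: congr_diag_def pos_def_diag_matrix)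
next
  assume "\<forall>i. d $ i > 0"
  then show "pos_def (congr_diag T d)"
    unfolding congr_diag_def by (intro pos_def_congruence T) (simp add: pos_def_diag_matrix)
qed

text \<open>The unit sphere is compact, so the quadratic form attains a positive minimum there.\<close>

lemma pos_def_lower_bound:
  fixes A :: "real^'q^'q"
  assumes "pos_def A"
  obtains l where "l > 0" "\<And>v. l * (norm v)\<^sup>2 \<le> v \<bullet> (A *v v)"
proof -
  have cont: "continuous_on (sphere 0 1) (\<lambda>x. x \<bullet> (A *v x))"
    by (intro continuous_intros matrix_vector_mult_linear_continuous_on)
  have "axis undefined 1 \<in> sphere (0::real^'q) 1" by (simp add: norm_axis_1)
  then have ne: "sphere (0::real^'q) 1 \<noteq> {}" by blast
  obtain u where u: "u \<in> sphere 0 1"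
    and min: "\<And>x. x \<in> sphere 0 1 \<Longrightarrow> u \<bullet> (A *v u) \<le> x \<bullet> (A *v x)"
    using continuous_attains_inf[OF compact_sphere ne cont] by blast
  have "u \<noteq> 0" using u by auto
  then have "u \<bullet> (A *v u) > 0" using assms unfolding pos_def_def by blast
  moreover have "u \<bullet> (A *v u) * (norm v)\<^sup>2 \<le> v \<bullet> (A *v v)" for v
  proof (cases "v = 0")
    case False
    define y where "y = v /\<^sub>R norm v"
    have v: "v = norm v *\<^sub>R y" using False by (simp add: y_def)
    have "u \<bullet> (A *v u) \<le> y \<bullet> (A *v y)" using False by (intro min) (simp add: y_def)
    moreover have "v \<bullet> (A *v v) = (norm v)\<^sup>2 * (y \<bullet> (A *v y))"
      by (subst (1 2) v) (simp add: matrix_vector_mult_scaleR power2_eq_square)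
    ultimately show ?thesis by (simp add: mult.commute mult_right_mono)
  qed simp
  ultimately show thesis by (rule that)
qed

section \<open>The spectral theorem and square roots\<close>

lemma symmetric_matrix_inner:
  fixes A :: "real^'q^'q"
  assumes "transpose A = A"
  shows "x \<bullet> (A *v y) = (A *v x) \<bullet> y"
  by (metis assms dot_lmul_matrix transpose_matrix_vector)

text \<open>The first-order condition at a maximizer \<open>u\<close> of the Rayleigh quotient on an invariant subspace.
The component \<open>w\<close> of \<open>Au\<close> orthogonal to \<open>u\<close> is an admissible direction, and moving from \<open>u\<close> to
\<open>u + hw\<close> changes the quadratic form by \<open>2h|w|\<^sup>2\<close> to first order in \<open>h\<close>; so \<open>w = 0\<close>.\<close>

lemma rayleigh_maximizer_is_eigenvector:
  fixes A :: "real^'q^'q"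
  assumes sym: "transpose A = A" and S: "subspace S" and inv: "\<And>x. x \<in> S \<Longrightarrow> A *v x \<in> S"
    and u: "u \<in> S" "norm u = 1"
    and max: "\<And>x. x \<in> S \<Longrightarrow> norm x = 1 \<Longrightarrow> x \<bullet> (A *v x) \<le> u \<bullet> (A *v u)"
  shows "A *v u = (u \<bullet> (A *v u)) *\<^sub>R u"
proof -
  define l where "l = u \<bullet> (A *v u)"
  define w where "w = A *v u - l *\<^sub>R u"
  have uu: "u \<bullet> u = 1" using u(2) by (simp add: norm_eq_1)
  have wS: "w \<in> S" unfolding w_def using S inv u(1) by (simp add: subspace_diff subspace_scale)
  have wu: "w \<bullet> u = 0" by (simp add: w_def l_def inner_diff_left uu inner_commute[of "A *v u" u])
  have wAu: "w \<bullet> (A *v u) = w \<bullet> w"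
  proof -
    have "A *v u = w + l *\<^sub>R u" by (simp add: w_def)
    then show ?thesis using wu by (simp add: inner_right_distrib)
  qed
  have all: "x \<bullet> (A *v x) \<le> l * (x \<bullet> x)" if "x \<in> S" for x
  proof (cases "x = 0")
    case False
    define y where "y = x /\<^sub>R norm x"
    have x: "x = norm x *\<^sub>R y" using False by (simp add: y_def)
    have "y \<bullet> (A *v y) \<le> l"
      unfolding l_def using False that S by (intro max) (auto simp: y_def subspace_scale)
    moreover have "x \<bullet> (A *v x) = (norm x)\<^sup>2 * (y \<bullet> (A *v y))"
      by (subst (1 2) x) (simp add: matrix_vector_mult_scaleR power2_eq_square)
    ultimately show ?thesis
      by (simp add: mult.commute mult_right_mono power2_norm_eq_inner[symmetric])
  qed simp
  have quad: "2 * h * (w \<bullet> w) \<le> h\<^sup>2 * (l * (w \<bullet> w) - w \<bullet> (A *v w))" for h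
  proof -
    have le: "(u + h *\<^sub>R w) \<bullet> (A *v (u + h *\<^sub>R w)) \<le> l * ((u + h *\<^sub>R w) \<bullet> (u + h *\<^sub>R w))"
      using all S u(1) wS by (simp add: subspace_add subspace_scale)
    have quadr: "(u + h *\<^sub>R w) \<bullet> (A *v (u + h *\<^sub>R w)) = l + 2 * h * (w \<bullet> w) + h\<^sup>2 * (w \<bullet> (A *v w))"
      using symmetric_matrix_inner[OF sym, of u w] wAu
      by (simp add: matrix_vector_right_distrib matrix_vector_mult_scaleR inner_left_distrib
          inner_right_distrib l_def power2_eq_square algebra_simps inner_commute)
    have normsq: "(u + h *\<^sub>R w) \<bullet> (u + h *\<^sub>R w) = 1 + h\<^sup>2 * (w \<bullet> w)"
      using wu by (simp add: inner_left_distrib inner_right_distrib uu power2_eq_square inner_commute)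
    show ?thesis using le unfolding quadr normsq by (simp add: algebra_simps)
  qed
  have "w \<bullet> w = 0"
  proof (rule ccontr)
    assume ne: "w \<bullet> w \<noteq> 0"
    define K where "K = \<bar>l * (w \<bullet> w) - w \<bullet> (A *v w)\<bar> + 1"
    \<comment> \<open>For this step size the first-order gain exceeds the quadratic loss, as \<open>K\<close> bounds its
      coefficient.\<close>
    define h where "h = (w \<bullet> w) / K"
    have pos: "w \<bullet> w > 0" using ne by simp
    have K: "K > 0" by (simp add: K_def)
    have h: "h > 0" using pos K by (simp add: h_def)
    have "h\<^sup>2 * (l * (w \<bullet> w) - w \<bullet> (A *v w)) \<le> h\<^sup>2 * K"
      by (rule mult_left_mono) (auto simp: K_def)
    also have "\<dots> = h * (w \<bullet> w)" using K by (simp add: h_def power2_eq_square)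
    also have "\<dots> < 2 * h * (w \<bullet> w)" using h pos by simp
    finally show False using quad[of h] by simp
  qed
  then show ?thesis unfolding w_def l_def by simp
qed

text \<open>Split off one eigenvector, the maximizer of the Rayleigh quotient; its orthogonal complement in \<open>S\<close>
is again invariant and has smaller dimension.\<close>

lemma symmetric_orthonormal_eigenbasis:
  fixes A :: "real^'q^'q"
  assumes sym: "transpose A = A"
  shows "subspace S \<Longrightarrow> (\<And>x. x \<in> S \<Longrightarrow> A *v x \<in> S) \<Longrightarrow>
    \<exists>B. pairwise orthogonal B \<and> (\<forall>b\<in>B. norm b = 1 \<and> (\<exists>l. A *v b = l *\<^sub>R b)) \<and> span B = S"
proof (induction "dim S" arbitrary: S rule: less_induct)
  case less
  note S = less.prems(1) and inv = less.prems(2)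
  show ?case
  proof (cases "S = {0}")
    case True
    then show ?thesis by (intro exI[of _ "{}"]) auto
  next
    case False
    then obtain x where x: "x \<in> S" "x \<noteq> 0" using S subspace_0 by blast
    have comp: "compact (S \<inter> sphere 0 1)"
      by (simp add: closed_Int_compact closed_subspace S)
    have ne: "S \<inter> sphere 0 1 \<noteq> {}"
    proof -
      have "x /\<^sub>R norm x \<in> S \<inter> sphere 0 1" using x S by (simp add: subspace_scale)
      then show ?thesis by blast
    qed
    obtain u where u: "u \<in> S \<inter> sphere 0 1"
      and max: "\<And>x. x \<in> S \<inter> sphere 0 1 \<Longrightarrow> x \<bullet> (A *v x) \<le> u \<bullet> (A *v u)"
    proof -
      have "continuous_on (S \<inter> sphere 0 1) (\<lambda>x. x \<bullet> (A *v x))"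
        by (intro continuous_intros matrix_vector_mult_linear_continuous_on)
      from continuous_attains_sup[OF comp ne this] show ?thesis using that by blast
    qed
    define l where "l = u \<bullet> (A *v u)"
    have Au: "A *v u = l *\<^sub>R u"
      unfolding l_def by (rule rayleigh_maximizer_is_eigenvector[OF sym S inv]) (use u max in auto)
    have uu: "u \<bullet> u = 1" using u by (simp add: norm_eq_1)
    define S' where "S' = {y \<in> S. u \<bullet> y = 0}"
    have S': "subspace S'"
      using S unfolding S'_def subspace_def by (auto simp: inner_right_distrib)
    have inv': "A *v y \<in> S'" if "y \<in> S'" for y
      using that inv symmetric_matrix_inner[OF sym, of u y] by (simp add: S'_def Au)
    have "u \<notin> S'" using uu by (simp add: S'_def)
    then have "S' \<noteq> S" using u by blast
    then have "S' \<subset> S" by (auto simp: S'_def)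
    then have "dim S' < dim S"
      using dim_psubset[of S' S] S S' by (simp add: span_eq_iff[THEN iffD2])
    from less.hyps[OF this S' inv'] obtain B where B: "pairwise orthogonal B"
      "\<And>b. b \<in> B \<Longrightarrow> norm b = 1 \<and> (\<exists>l. A *v b = l *\<^sub>R b)" "span B = S'" by blast
    have ortho: "orthogonal u b" if "b \<in> B" for b
      using B(3) span_base[OF that] by (auto simp: S'_def orthogonal_def)
    have "span (insert u B) = S"
    proof
      show "span (insert u B) \<subseteq> S"
        using u B(3) span_superset[of B] S by (intro span_minimal) (auto simp: S'_def)
      show "S \<subseteq> span (insert u B)"
      proof
        fix y assume y: "y \<in> S"
        have "y - (u \<bullet> y) *\<^sub>R u \<in> S'"
          using y u S uu by (simp add: S'_def subspace_diff subspace_scale inner_diff_right)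
        then show "y \<in> span (insert u B)"
          unfolding span_insert B(3) by blast
      qed
    qed
    moreover have "pairwise orthogonal (insert u B)"
      using B(1) ortho by (auto simp: pairwise_insert orthogonal_commute)
    ultimately show ?thesis
      using B(2) u Au by (intro exI[of _ "insert u B"]) auto
  qed
qed

theorem symmetric_matrix_spectral:
  fixes A :: "real^'q^'q"
  assumes sym: "transpose A = A"
  obtains P d where "orthogonal_matrix P" "A = congr_diag P d"
proof -
  obtain B where B: "pairwise orthogonal B"
      "\<And>b. b \<in> B \<Longrightarrow> norm b = 1" "\<And>b. b \<in> B \<Longrightarrow> \<exists>l. A *v b = l *\<^sub>R b" "span B = UNIV"
    using symmetric_orthonormal_eigenbasis[OF sym, of UNIV] by auto
  have "0 \<notin> B" using B(2)[of 0] by auto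
  then have ind: "independent B" using B(1) by (rule pairwise_orthogonal_independent[rotated])
  then have fin: "finite B" by (rule independent_imp_finite)
  have "card B = CARD('q)"
    using basis_card_eq_dim[of B UNIV] B(4) ind by simp
  then obtain f where f: "bij_betw f (UNIV::'q set) B"
    using fin by (metis finite_class.finite_UNIV finite_same_card_bij)
  then have fB: "f i \<in> B" for i by (auto dest: bij_betwE)
  have inj: "f i \<noteq> f j" if "i \<noteq> j" for i j
    using f that by (auto simp: bij_betw_def inj_on_def)
  obtain l where l: "\<And>i. A *v f i = l i *\<^sub>R f i" using B(3)[OF fB] by metis
  define P :: "real^'q^'q" where "P = (\<chi> i j. f j $ i)"
  have col: "column j P = f j" for j by (simp add: column_def P_def)
  have P: "orthogonal_matrix P"
    unfolding orthogonal_matrix_orthonormal_columns col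
    using B(2) fB B(1) inj by (auto simp: pairwise_def)
  have "A ** P = P ** diag_matrix (\<chi> i. l i)"
  proof -
    have "(A ** P) $ i $ j = (P ** diag_matrix (\<chi> i. l i)) $ i $ j" for i j
    proof -
      have "(A ** P) $ i $ j = (A *v f j) $ i"
        by (simp add: matrix_matrix_mult_def matrix_vector_mult_def P_def)
      also have "\<dots> = (P ** diag_matrix (\<chi> i. l i)) $ i $ j"
        unfolding l
        by (simp add: matrix_matrix_mult_def diag_matrix_def P_def if_distrib[of "\<lambda>x. _ * x"] cong: if_cong)
      finally show ?thesis .
    qed
    then show ?thesis by (simp add: vec_eq_iff)
  qed
  then have "A ** P ** transpose P = congr_diag P (\<chi> i. l i)" by (simp add: congr_diag_def)
  moreover have "A ** P ** transpose P = A"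
    using P by (simp add: matrix_mul_assoc[symmetric] orthogonal_matrix_def)
  ultimately show thesis using that P by simp
qed

lemma orthogonal_imp_invertible: "orthogonal_matrix P \<Longrightarrow> invertible P"
  by (auto simp: orthogonal_matrix_def invertible_def)

text \<open>This removes the definite description from \<^const>\<open>mpow\<close>: any orthogonal diagonalization may be
used to compute powers.\<close>

lemma mpow_congr_diag:
  assumes "orthogonal_matrix P"
  shows "mpow (congr_diag P d) t = congr_diag P (\<chi> i. (d $ i) powr t)"
proof -
  have "is_mpow (congr_diag P d) t (congr_diag P (\<chi> i. (d $ i) powr t))"
    unfolding is_mpow_def congr_diag_def using assms by blast
  then show ?thesis unfolding mpow_def by (rule the_equality) (metis mpow_unique \<open>is_mpow _ _ _\<close>)
qed

lemma pos_def_square_roots: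
  fixes A :: "real^'q^'q"
  assumes "pos_def A"
  defines "R \<equiv> mpow A (1/2)" and "R' \<equiv> mpow A (-1/2)"
  shows "transpose R = R" "transpose R' = R'" "R ** R = A" "R ** R' = mat 1" "R' ** R = mat 1"
proof -
  obtain P d where P: "orthogonal_matrix P" and A: "A = congr_diag P d"
    using symmetric_matrix_spectral assms(1) unfolding pos_def_def by blast
  have d: "d $ i > 0" for i
    using assms(1) A pos_def_congr_diag[OF orthogonal_imp_invertible[OF P]] by simp
  have R: "R = congr_diag P (\<chi> i. (d $ i) powr (1/2))" "R' = congr_diag P (\<chi> i. (d $ i) powr (-1/2))"
    unfolding R_def R'_def A by (simp_all add: mpow_congr_diag P)
  have PP: "P ** transpose P = mat 1" using P by (simp add: orthogonal_matrix_def)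
  show "transpose R = R" "transpose R' = R'" by (simp_all add: R)
  show "R ** R = A" "R ** R' = mat 1" "R' ** R = mat 1"
    using d by (simp_all add: R congr_diag_orthogonal_mult[OF P] powr_add[symmetric] less_imp_neq[symmetric] congr_diag_one PP)
      (simp add: A less_imp_le)
qed

section \<open>Geodesics\<close>

text \<open>With \<open>A = TT\<^sup>T\<close>, the matrix \<open>P = A\<^sup>-\<^sup>1\<^sup>/\<^sup>2 T\<close> is orthogonal and diagonalizes the inner factor
\<open>A\<^sup>-\<^sup>1\<^sup>/\<^sup>2 B A\<^sup>-\<^sup>1\<^sup>/\<^sup>2\<close> of the geodesic, and \<open>A\<^sup>1\<^sup>/\<^sup>2 P = T\<close> puts the power back into place. The
factor \<open>T\<close> of \<open>A\<close> is free up to an orthogonal matrix, which is used to adapt it to \<open>B\<close>.\<close>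

theorem geodesic_congr_diag:
  fixes T :: "real^'q^'q"
  assumes T: "invertible T"
  shows "geodesic (T ** transpose T) (congr_diag T d) t = congr_diag T (\<chi> i. (d $ i) powr t)"
proof -
  define A where "A = T ** transpose T"
  have A: "pos_def A"
    unfolding A_def congr_diag_one[symmetric] using T by (simp add: pos_def_congr_diag)
  define R where "R = mpow A (1/2)"
  define R' where "R' = mpow A (-1/2)"
  note R = pos_def_square_roots[OF A, folded R_def R'_def]
  define P where "P = R' ** T"
  have "P ** transpose P = R' ** A ** R'"
    by (simp add: P_def A_def matrix_transpose_mul R matrix_mul_assoc)
  also have "\<dots> = (R' ** R) ** (R ** R')" by (simp add: R(3)[symmetric] matrix_mul_assoc)
  finally have P: "orthogonal_matrix P"
    by (metis R(4,5) matrix_mul_lid orthogonal_matrix orthogonal_matrix_transpose transpose_transpose)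
  have RP: "R ** P = T" by (simp add: P_def matrix_mul_assoc R)
  have "R' ** congr_diag T d ** R' = congr_diag P d"
    using congr_diag_left[of R' T d] by (simp add: R P_def)
  then have "geodesic A (congr_diag T d) t = R ** congr_diag P (\<chi> i. (d $ i) powr t) ** R"
    unfolding geodesic_def R_def[symmetric] R'_def[symmetric] by (simp add: mpow_congr_diag P)
  also have "\<dots> = congr_diag T (\<chi> i. (d $ i) powr t)"
    using congr_diag_left[of R P] by (simp add: R RP)
  finally show ?thesis by (simp add: A_def)
qed

text \<open>Together with \<open>geodesic_congr_diag\<close>, this reduces every computation along a geodesic to powers of
positive numbers.\<close>

theorem pos_def_simultaneous_diagonalization:
  fixes A B :: "real^'q^'q"
  assumes A: "pos_def A" and B: "pos_def B"
  obtains T d where "invertible T" "\<And>i. d $ i > 0" "A = T ** transpose T" "B = congr_diag T d"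
proof -
  define R where "R = mpow A (1/2)"
  define R' where "R' = mpow A (-1/2)"
  note R = pos_def_square_roots[OF A, folded R_def R'_def]
  have "invertible R'" using R by (auto simp: invertible_def)
  from pos_def_congruence[OF B this] have pd: "pos_def (R' ** B ** R')" by (simp add: R)
  obtain P d where P: "orthogonal_matrix P" and C: "R' ** B ** R' = congr_diag P d"
    using symmetric_matrix_spectral pd unfolding pos_def_def by blast
  have d: "d $ i > 0" for i
    using pd C pos_def_congr_diag[OF orthogonal_imp_invertible[OF P]] by simp
  have inv: "invertible (R ** P)"
    using R orthogonal_imp_invertible[OF P] by (intro invertible_mult) (auto simp: invertible_def)
  have "(R ** P) ** transpose (R ** P) = R ** (P ** transpose P) ** R"
    by (simp add: matrix_transpose_mul R matrix_mul_assoc)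
  then have 1: "A = (R ** P) ** transpose (R ** P)"
    using P by (simp add: orthogonal_matrix_def R)
  have "congr_diag (R ** P) d = (R ** R') ** B ** (R' ** R)"
    using congr_diag_left[of R P d] by (simp add: C[symmetric] R(1) matrix_mul_assoc)
  then have 2: "B = congr_diag (R ** P) d" by (simp add: R)
  show thesis using that inv d 1 2 by blast
qed

lemma geodesic_0:
  assumes "pos_def A" "pos_def B"
  shows "geodesic A B 0 = A"
proof -
  obtain T d where T: "invertible T" and d: "\<And>i. d $ i > 0"
    and A: "A = T ** transpose T" and B: "B = congr_diag T d"
    using pos_def_simultaneous_diagonalization assms by metis
  show ?thesis
    using d by (simp add: A B geodesic_congr_diag[OF T] less_imp_neq[symmetric] congr_diag_one)
qed

lemma pos_def_geodesic:
  assumes "pos_def A" "pos_def B"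
  shows "pos_def (geodesic A B t)"
proof -
  obtain T d where T: "invertible T" and d: "\<And>i. d $ i > 0"
    and A: "A = T ** transpose T" and B: "B = congr_diag T d"
    using pos_def_simultaneous_diagonalization assms by metis
  show ?thesis
    using d by (simp add: A B geodesic_congr_diag[OF T] pos_def_congr_diag[OF T] less_imp_neq[symmetric])
qed

text \<open>An initial piece of a geodesic is a geodesic, run at proportional speed.\<close>

lemma geodesic_geodesic:
  assumes "pos_def A" "pos_def B"
  shows "geodesic A (geodesic A B t) r = geodesic A B (t * r)"
proof -
  obtain T d where T: "invertible T" and d: "\<And>i. d $ i > 0"
    and A: "A = T ** transpose T" and B: "B = congr_diag T d"
    using pos_def_simultaneous_diagonalization assms by metis
  show ?thesis by (simp add: A B geodesic_congr_diag[OF T] powr_powr)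
qed

lemma geodesic_1:
  assumes "pos_def A" "pos_def B"
  shows "geodesic A B 1 = B"
proof -
  obtain T d where T: "invertible T" and d: "\<And>i. d $ i > 0"
    and A: "A = T ** transpose T" and B: "B = congr_diag T d"
    using pos_def_simultaneous_diagonalization assms by metis
  show ?thesis using d by (simp add: A B geodesic_congr_diag[OF T] less_imp_le)
qed

lemma g_convexD:
  assumes "g_convex f" "pos_def A" "pos_def B" "0 \<le> t" "t \<le> 1"
  shows "f (geodesic A B t) \<le> (1 - t) * f A + t * f B"
proof -
  have "t = 0 \<or> t = 1 \<or> (0 < t \<and> t < 1)" using assms(4,5) by auto
  then show ?thesis
    using assms(1-3) geodesic_0[OF assms(2,3)] geodesic_1[OF assms(2,3)]
    unfolding g_convex_def by auto
qed

section \<open>Rank-one lines are geodesics\<close>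

lemma outer_mult_vector: "outer v w *v u = (w \<bullet> u) *\<^sub>R v"
  by (simp add: vec_eq_iff outer_def matrix_vector_mult_def inner_vec_def sum_distrib_right
      sum_distrib_left algebra_simps)

lemma congruence_outer:
  fixes T :: "real^'q^'q"
  shows "T ** outer v w ** transpose T = outer (T *v v) (T *v w)"
proof -
  have "T ** outer v w = outer (T *v v) w" for v w :: "real^'q"
    by (simp add: vec_eq_iff outer_def matrix_matrix_mult_def matrix_vector_mult_def
        sum_distrib_left algebra_simps)
  moreover have "outer v w ** transpose T = outer v (T *v w)" for v w :: "real^'q"
    by (simp add: vec_eq_iff outer_def matrix_matrix_mult_def matrix_vector_mult_def transpose_def
        sum_distrib_left algebra_simps)
  ultimately show ?thesis by simp
qed

lemma outer_scaleR: "outer (c *\<^sub>R v) (c *\<^sub>R v) = c\<^sup>2 *\<^sub>R outer v v"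
  by (simp add: vec_eq_iff outer_def power2_eq_square)

lemma transpose_outer [simp]: "transpose (outer v v) = outer v v"
  by (simp add: vec_eq_iff outer_def transpose_def)

lemma matrix_add_rdistrib: "(A + B) ** C = A ** C + B ** (C :: 'a::semiring_1^'m^'n)"
  by (vector matrix_matrix_mult_def sum.distrib[symmetric] distrib_right)

text \<open>Relative to \<open>X\<close>, only one eigenvalue changes along the line. With \<open>w = X\<^sup>-\<^sup>1\<^sup>/\<^sup>2 v\<close> and an orthogonal
\<open>P\<close> that takes a basis vector to \<open>w/|w|\<close>, the matrix \<open>T = X\<^sup>1\<^sup>/\<^sup>2 P\<close> takes it to \<open>v/|w|\<close>, so
\<open>a = |w|\<^sup>2 = v\<^sup>TX\<inverse>v\<close>.\<close>

lemma rank_one_line_congr_diag: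
  fixes X :: "real^'q^'q"
  assumes X: "pos_def X" and v: "v \<noteq> 0"
  obtains T k a where "invertible T" "a > 0"
    "\<And>s. X + s *\<^sub>R outer v v = congr_diag T (\<chi> i. if i = k then 1 + s * a else 1)"
proof -
  define R where "R = mpow X (1/2)"
  define R' where "R' = mpow X (-1/2)"
  note R = pos_def_square_roots[OF X, folded R_def R'_def]
  define w where "w = R' *v v"
  have Rw: "R *v w = v" by (simp add: w_def matrix_vector_mul_assoc R)
  then have w: "w \<noteq> 0" using v by auto
  obtain k :: 'q where True by simp
  have "norm (w /\<^sub>R norm w) = 1" using w by simp
  then obtain P where P: "orthogonal_matrix P" and Pk: "P *v axis k 1 = w /\<^sub>R norm w"
    by (rule orthogonal_matrix_exists_basis)
  define T where "T = R ** P"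
  have Tk: "T *v axis k 1 = (1 / norm w) *\<^sub>R v"
    by (simp add: T_def matrix_vector_mul_assoc[symmetric] Pk matrix_vector_mult_scaleR Rw divide_inverse_commute)
  have TT: "T ** transpose T = X"
  proof -
    have "T ** transpose T = R ** (P ** transpose P) ** R"
      by (simp add: T_def matrix_transpose_mul R matrix_mul_assoc)
    then show ?thesis using P by (simp add: orthogonal_matrix_def R)
  qed
  have inv: "invertible T"
    unfolding T_def
    using R orthogonal_imp_invertible[OF P] by (intro invertible_mult) (auto simp: invertible_def)
  have "X + s *\<^sub>R outer v v = congr_diag T (\<chi> i. if i = k then 1 + s * (norm w)\<^sup>2 else 1)" for s
  proof -
    have "diag_matrix (\<chi> i. if i = k then 1 + s * (norm w)\<^sup>2 else 1)
        = mat 1 + (s * (norm w)\<^sup>2) *\<^sub>R outer (axis k 1) (axis k 1)"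
      by (auto simp: vec_eq_iff diag_matrix_def mat_def outer_def axis_def)
    then have "congr_diag T (\<chi> i. if i = k then 1 + s * (norm w)\<^sup>2 else 1)
        = T ** transpose T + (s * (norm w)\<^sup>2) *\<^sub>R (T ** outer (axis k 1) (axis k 1) ** transpose T)"
      by (simp add: congr_diag_def matrix_add_ldistrib matrix_add_rdistrib
          matrix_scalar_ac scalar_matrix_assoc[symmetric])
    also have "\<dots> = X + s *\<^sub>R outer v v"
      unfolding congruence_outer Tk outer_scaleR TT using w by (simp add: power_divide)
    finally show ?thesis by simp
  qed
  with inv w show thesis by (intro that[of T "(norm w)\<^sup>2" k]) auto
qed

text \<open>The geodesic from \<open>X\<close> to \<open>X + c vv\<^sup>T\<close> stays on the straight line through these points; only the
parameter is distorted, since the single moving eigenvalue is \<open>(1 + ca)\<^sup>t\<close>.\<close>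

lemma rank_one_geodesic:
  fixes X :: "real^'q^'q"
  assumes X: "pos_def X" and v: "v \<noteq> 0"
  obtains a where "a > 0" "\<And>s. pos_def (X + s *\<^sub>R outer v v) \<longleftrightarrow> 1 + s * a > 0"
    "\<And>c t. geodesic X (X + c *\<^sub>R outer v v) t = X + (((1 + c * a) powr t - 1) / a) *\<^sub>R outer v v"
proof -
  obtain T k a where T: "invertible T" and a: "a > 0"
    and line: "\<And>s. X + s *\<^sub>R outer v v = congr_diag T (\<chi> i. if i = k then 1 + s * a else 1)"
    using rank_one_line_congr_diag[OF X v] by metis
  have pd: "pos_def (X + s *\<^sub>R outer v v) \<longleftrightarrow> 1 + s * a > 0" for s
    unfolding line pos_def_congr_diag[OF T] by auto
  have TT: "X = T ** transpose T"
    using line[of 0]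
    by (simp only: mult_zero_left scaleR_zero_left add_0_right if_cancel congr_diag_one)
  have "geodesic X (X + c *\<^sub>R outer v v) t = X + (((1 + c * a) powr t - 1) / a) *\<^sub>R outer v v" for c t
  proof -
    have "geodesic X (X + c *\<^sub>R outer v v) t
        = congr_diag T (\<chi> i. (if i = k then 1 + c * a else 1) powr t)"
      unfolding line by (subst TT) (simp add: geodesic_congr_diag[OF T])
    also have "(\<chi> i. (if i = k then 1 + c * a else 1) powr t)
        = (\<chi> i. if i = k then 1 + (((1 + c * a) powr t - 1) / a) * a else 1)"
      using a by (simp add: vec_eq_iff)
    finally show ?thesis unfolding line .
  qed
  with a pd show thesis by (rule that)
qed

section \<open>Continuity of g-convex functions\<close>

text \<open>On a straight segment in a rank-one direction, a g-convex function is a convex function of the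
geodesic parameter, so it is at most the larger of the values at the two ends.\<close>

lemma g_convex_rank_one_segment_bound:
  fixes X :: "real^'q^'q"
  assumes f: "g_convex f"
    and pd: "pos_def (X + s1 *\<^sub>R outer v v)" "pos_def (X + s2 *\<^sub>R outer v v)"
    and bd: "f (X + s1 *\<^sub>R outer v v) \<le> M" "f (X + s2 *\<^sub>R outer v v) \<le> M"
    and s: "s1 \<le> s" "s \<le> s2"
  shows "f (X + s *\<^sub>R outer v v) \<le> M"
proof (cases "v = 0 \<or> s1 = s2")
  case True
  moreover have "outer 0 0 = (0::real^'q^'q)" by (simp add: vec_eq_iff outer_def)
  ultimately show ?thesis using bd s by (elim disjE) auto
next
  case False
  then have v: "v \<noteq> 0" and c: "s2 - s1 > 0" using s by auto
  define Y where "Y = X + s1 *\<^sub>R outer v v"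
  have Y: "X + r *\<^sub>R outer v v = Y + (r - s1) *\<^sub>R outer v v" for r
    by (simp add: Y_def algebra_simps)
  obtain a where a: "a > 0"
    and geo: "\<And>c t. geodesic Y (Y + c *\<^sub>R outer v v) t = Y + (((1 + c * a) powr t - 1) / a) *\<^sub>R outer v v"
    using rank_one_geodesic[OF pd(1)[folded Y_def] v] by metis
  \<comment> \<open>The parameter at which the geodesic from \<open>Y\<close> to the other end passes through the given point.\<close>
  define t where "t = ln (1 + (s - s1) * a) / ln (1 + (s2 - s1) * a)"
  have pos: "ln (1 + (s2 - s1) * a) > 0" by (intro ln_gt_zero) (use a c in simp)
  have ge: "1 + (s - s1) * a \<ge> 1" "1 + (s - s1) * a \<le> 1 + (s2 - s1) * a"
    using a s by (auto intro: mult_right_mono)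
  have t: "0 \<le> t" "t \<le> 1"
    using pos ge unfolding t_def by (auto simp: divide_le_eq_1)
  have "(1 + (s2 - s1) * a) powr t = 1 + (s - s1) * a"
    using pos ge unfolding t_def powr_def by auto
  then have "X + s *\<^sub>R outer v v = geodesic Y (X + s2 *\<^sub>R outer v v) t"
    unfolding Y[of s2] geo using a by (simp add: Y[of s])
  also have "f \<dots> \<le> (1 - t) * f Y + t * f (X + s2 *\<^sub>R outer v v)"
    using pd t unfolding Y_def by (intro g_convexD f)
  also have "\<dots> \<le> (1 - t) * M + t * M"
    using bd t unfolding Y_def by (intro add_mono mult_left_mono) auto
  finally show ?thesis by (simp add: algebra_simps)
qed

text \<open>Continue the step from \<open>X\<close> to \<open>Y = X + s vv\<^sup>T\<close> along the geodesic to \<open>m\<close> times its length, reaching a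
point \<open>Z = X + r vv\<^sup>T\<close>. Convexity gives \<open>f Y \<le> (1 - 1/m) f X + f Z / m\<close>, and \<open>f Z \<le> M\<close> as long as
\<open>|r| \<le> e\<close>. Since \<open>1 + ra = (1 + sa)\<^sup>m\<close>, the number \<open>r\<close> is \<open>s\<close> times a geometric sum of \<open>m\<close> terms
of size at most \<open>2\<^sup>m\<close>, which explains the bound on \<open>s\<close>. The positive definiteness of \<open>X - e vv\<^sup>T\<close>
amounts to \<open>a < 1/e\<close>: it keeps the estimate uniform in \<open>X\<close>.\<close>

lemma g_convex_rank_one_step:
  fixes X :: "real^'q^'q"
  assumes f: "g_convex f" and X: "pos_def X" and e: "e > 0"
    and low: "pos_def (X - e *\<^sub>R outer v v)"
    and bd: "\<And>r. \<bar>r\<bar> \<le> e \<Longrightarrow> f (X + r *\<^sub>R outer v v) \<le> M"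
    and m: "m \<ge> 1" and s: "\<bar>s\<bar> \<le> e / (real m * 2 ^ m)"
  shows "(1 - 1 / real m) * (M - f X) \<le> M - f (X + s *\<^sub>R outer v v)"
proof (cases "v = 0")
  case True
  then have 0: "outer v v = (0::real^'q^'q)" by (simp add: vec_eq_iff outer_def)
  have "f X \<le> M" using bd[of 0] e by simp
  then show ?thesis using m by (simp add: 0 mult_left_le_one_le)
next
  case False
  obtain a where a: "a > 0"
    and pd: "\<And>s. pos_def (X + s *\<^sub>R outer v v) \<longleftrightarrow> 1 + s * a > 0"
    and geo: "\<And>c t. geodesic X (X + c *\<^sub>R outer v v) t = X + (((1 + c * a) powr t - 1) / a) *\<^sub>R outer v v"
    using rank_one_geodesic[OF X False] by metis
  \<comment> \<open>This is where \<open>X - e vv\<^sup>T\<close> enters; it keeps \<open>1 + sa\<close> between \<open>0\<close> and \<open>2\<close>.\<close>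
  have ea: "e * a < 1" using pd[of "-e"] low by simp
  have "real m * 2 ^ m \<ge> 1 * 1" using m by (intro mult_mono) auto
  then have "e / (real m * 2 ^ m) \<le> e" using e by (simp add: divide_le_eq mult_le_cancel_left1)
  with s have "\<bar>s\<bar> \<le> e" by simp
  then have "\<bar>s\<bar> * a \<le> e * a" using a by (intro mult_right_mono) auto
  moreover have "\<bar>s * a\<bar> = \<bar>s\<bar> * a" using a by (simp add: abs_mult)
  ultimately have sa: "\<bar>s * a\<bar> < 1" using ea by linarith
  define b where "b = 1 + s * a"
  have b: "0 < b" "b < 2" using sa unfolding b_def by linarith+
  define r where "r = (b ^ m - 1) / a"
  have r: "r = s * (\<Sum>i<m. b ^ i)"
    using a by (simp add: r_def power_diff_1_eq b_def)
  have "\<bar>\<Sum>i<m. b ^ i\<bar> \<le> (\<Sum>i<m. 2 ^ m)"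
  proof -
    have "b ^ i \<le> 2 ^ m" if "i < m" for i
    proof -
      have "b ^ i \<le> 2 ^ i" using b by (intro power_mono) auto
      also have "\<dots> \<le> 2 ^ m" using that by (intro power_increasing) auto
      finally show ?thesis .
    qed
    moreover have "0 \<le> (\<Sum>i<m. b ^ i)" using b by (intro sum_nonneg) auto
    ultimately show ?thesis by (simp only: abs_of_nonneg) (intro sum_mono, auto)
  qed
  then have "\<bar>r\<bar> \<le> e / (real m * 2 ^ m) * (real m * 2 ^ m)"
    unfolding r abs_mult using s e by (intro mult_mono) auto
  then have re: "\<bar>r\<bar> \<le> e" using m by simp
  have ra: "1 + r * a = b ^ m" using a by (simp add: r_def)
  have "(b ^ m) powr (1 / real m) = b"
    using b m by (simp add: powr_realpow[symmetric] powr_powr)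
  then have "X + s *\<^sub>R outer v v = geodesic X (X + r *\<^sub>R outer v v) (1 / real m)"
    unfolding geo ra using a by (simp add: b_def)
  also have "f \<dots> \<le> (1 - 1 / real m) * f X + (1 / real m) * f (X + r *\<^sub>R outer v v)"
    using m b by (intro g_convexD f X) (auto simp: pd ra)
  also have "\<dots> \<le> (1 - 1 / real m) * f X + (1 / real m) * M"
    using bd[OF re] by (intro add_left_mono mult_left_mono) auto
  finally show ?thesis by (simp add: algebra_simps diff_divide_distrib)
qed

text \<open>Linear coordinates \<open>s\<close> around \<open>P\<close> in which every coordinate line is a rank-one line.\<close>

definition rank_one_pencil ::
  "('k::finite \<Rightarrow> real^'q) \<Rightarrow> real^'q^'q \<Rightarrow> ('k \<Rightarrow> real) \<Rightarrow> real^'q^'q" where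
  "rank_one_pencil v P s = P + (\<Sum>k\<in>UNIV. s k *\<^sub>R outer (v k) (v k))"

lemma rank_one_pencil_upd:
  "rank_one_pencil v P (s(k := r)) = rank_one_pencil v P s + (r - s k) *\<^sub>R outer (v k) (v k)"
proof -
  have "(\<Sum>j\<in>UNIV. (s(k := r)) j *\<^sub>R outer (v j) (v j))
      = (\<Sum>j\<in>UNIV. s j *\<^sub>R outer (v j) (v j) + (if j = k then (r - s k) *\<^sub>R outer (v k) (v k) else 0))"
    by (intro sum.cong) (auto simp: algebra_simps)
  then show ?thesis by (simp add: rank_one_pencil_def sum.distrib add.assoc)
qed

text \<open>Along each coordinate line, the value is at most the larger of the values at the two ends. Moving
the coordinates to the ends one after the other bounds \<open>f\<close> on the cube by its maximum over the
finitely many corners.\<close>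

lemma g_convex_bounded_on_pencil:
  fixes v :: "'k::finite \<Rightarrow> real^'q"
  assumes f: "g_convex f" and e: "e \<ge> 0"
    and pd: "\<And>s. (\<And>k. \<bar>s k\<bar> \<le> e) \<Longrightarrow> pos_def (rank_one_pencil v P s)"
  shows "\<exists>M. \<forall>s. (\<forall>k. \<bar>s k\<bar> \<le> e) \<longrightarrow> f (rank_one_pencil v P s) \<le> M"
proof -
  define V where "V = {s :: 'k \<Rightarrow> real. \<forall>k. s k \<in> {-e, e}}"
  have "V = PiE UNIV (\<lambda>_. {-e, e})" by (auto simp: V_def PiE_def)
  then have "finite V" by (simp add: finite_PiE)
  then obtain M where M: "\<And>s. s \<in> V \<Longrightarrow> f (rank_one_pencil v P s) \<le> M"
    by (meson finite_imageI Max_ge imageI)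
  have "\<forall>s. (\<forall>k\<in>J. \<bar>s k\<bar> \<le> e) \<and> (\<forall>k. k \<notin> J \<longrightarrow> s k \<in> {-e, e}) \<longrightarrow> f (rank_one_pencil v P s) \<le> M"
    if "finite J" for J
    using that
  proof (induction J)
    case empty
    then show ?case using M by (auto simp: V_def)
  next
    case (insert j J)
    show ?case
    proof (intro allI impI, elim conjE)
      fix s assume s: "\<forall>k\<in>insert j J. \<bar>s k\<bar> \<le> e" "\<forall>k. k \<notin> insert j J \<longrightarrow> s k \<in> {-e, e}"
      define X where "X = rank_one_pencil v P s"
      have *: "f (rank_one_pencil v P (s(j := r))) \<le> M \<and> pos_def (rank_one_pencil v P (s(j := r)))"
        if "r \<in> {-e, e}" for r
      proof
        show "f (rank_one_pencil v P (s(j := r))) \<le> M"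
          using insert that s by (intro insert.IH[rule_format]) auto
        have "\<bar>(s(j := r)) k\<bar> \<le> e" for k
          using s that e by (cases "k \<in> insert j J") auto
        then show "pos_def (rank_one_pencil v P (s(j := r)))" by (rule pd)
      qed
      have ends: "f (X + (-e - s j) *\<^sub>R outer (v j) (v j)) \<le> M"
          "pos_def (X + (-e - s j) *\<^sub>R outer (v j) (v j))"
          "f (X + (e - s j) *\<^sub>R outer (v j) (v j)) \<le> M"
          "pos_def (X + (e - s j) *\<^sub>R outer (v j) (v j))"
        using *[of "-e"] *[of e] unfolding X_def rank_one_pencil_upd by blast+
      have "f (X + 0 *\<^sub>R outer (v j) (v j)) \<le> M"
        using g_convex_rank_one_segment_bound[OF f ends(2,4,1,3), of 0] s(1) by auto
      then show "f (rank_one_pencil v P s) \<le> M" by (simp add: X_def)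
    qed
  qed
  from this[OF finite_class.finite_UNIV] show ?thesis by auto
qed

text \<open>Walk between \<open>P\<close> and the given point of the cube by changing one coordinate at a time. Each step
costs a factor \<open>1 - 1/m\<close> in the nonnegative quantity \<open>M - f\<close>, and the walk can be taken in both
directions.\<close>

lemma g_convex_pencil_comparison:
  fixes v :: "'k::finite \<Rightarrow> real^'q"
  assumes f: "g_convex f" and e: "e > 0"
    and pd: "\<And>s. (\<And>k. \<bar>s k\<bar> \<le> 2 * e) \<Longrightarrow> pos_def (rank_one_pencil v P s)"
    and M: "\<And>s. (\<And>k. \<bar>s k\<bar> \<le> 2 * e) \<Longrightarrow> f (rank_one_pencil v P s) \<le> M"
    and m: "m \<ge> 1" and s: "\<And>k. \<bar>s k\<bar> \<le> e / (real m * 2 ^ m)"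
  defines "\<theta> \<equiv> (1 - 1 / real m) ^ CARD('k)"
  shows "\<theta> * (M - f P) \<le> M - f (rank_one_pencil v P s)"
    and "\<theta> * (M - f (rank_one_pencil v P s)) \<le> M - f P"
proof -
  define c where "c = 1 - 1 / real m"
  have c: "0 \<le> c" using m by (simp add: c_def)
  define h where "h = (\<lambda>s. M - f (rank_one_pencil v P s))"
  have "real m * 2 ^ m \<ge> 1 * 1" using m by (intro mult_mono) auto
  then have se: "\<bar>s k\<bar> \<le> e" for k
    using s[of k] e by (smt (verit) divide_le_eq mult_le_cancel_left1)
  have step: "c * h z \<le> h (z(k := r))"
    if z: "\<And>j. \<bar>z j\<bar> \<le> e" and r: "\<bar>r - z k\<bar> \<le> e / (real m * 2 ^ m)" for z k r
  proof -
    \<comment> \<open>The walk stays in the cube of half-width \<open>e\<close>; the extended steps need the one of half-width \<open>2e\<close>.\<close>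
    have upd: "\<bar>(z(k := z k + y)) j\<bar> \<le> 2 * e" if "\<bar>y\<bar> \<le> e" for y j
      using z[of j] that by auto
    have "c * (M - f (rank_one_pencil v P z))
      \<le> M - f (rank_one_pencil v P z + (r - z k) *\<^sub>R outer (v k) (v k))"
      unfolding c_def
    proof (rule g_convex_rank_one_step[OF f _ e _ _ m r])
      show "pos_def (rank_one_pencil v P z)" 
      proof (rule pd)
        show "\<bar>z j\<bar> \<le> 2 * e" for j using z[of j] e by linarith
      qed
      have "pos_def (rank_one_pencil v P (z(k := z k + (- e))))"
        using e by (intro pd upd) auto
      then show "pos_def (rank_one_pencil v P z - e *\<^sub>R outer (v k) (v k))"
        by (simp add: rank_one_pencil_upd)
      fix y assume "\<bar>y\<bar> \<le> e"
      then have "f (rank_one_pencil v P (z(k := z k + y))) \<le> M" by (intro M upd)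
      then show "f (rank_one_pencil v P z + y *\<^sub>R outer (v k) (v k)) \<le> M"
        by (simp add: rank_one_pencil_upd)
    qed
    then show ?thesis by (simp add: h_def rank_one_pencil_upd)
  qed
  have walk: "c ^ card J * h (\<lambda>_. 0) \<le> h (\<lambda>k. if k \<in> J then s k else 0) \<and>
      c ^ card J * h (\<lambda>k. if k \<in> J then s k else 0) \<le> h (\<lambda>_. 0)" if "finite J" for J
    using that
  proof (induction J)
    case (insert j J)
    define z where "z = (\<lambda>k. if k \<in> J then s k else 0)"
    have z': "(\<lambda>k. if k \<in> insert j J then s k else 0) = z(j := s j)" by (auto simp: z_def)
    have zj: "z j = 0" using insert by (simp add: z_def)
    have 1: "c * h z \<le> h (z(j := s j))"
      using se s e by (intro step) (auto simp: zj, auto simp: z_def)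
    have "c * h (z(j := s j)) \<le> h ((z(j := s j))(j := 0))"
      using se s e by (intro step) (auto simp: z_def)
    then have 2: "c * h (z(j := s j)) \<le> h z" by (simp add: zj[symmetric] fun_upd_idem)
    have "c ^ card (insert j J) * h (\<lambda>_. 0) = c * (c ^ card J * h (\<lambda>_. 0))"
      using insert by simp
    also have "\<dots> \<le> c * h z" using insert.IH c unfolding z_def by (intro mult_left_mono) auto
    finally have 3: "c ^ card (insert j J) * h (\<lambda>_. 0) \<le> h (z(j := s j))" using 1 by simp
    have "c ^ card (insert j J) * h (z(j := s j)) = c ^ card J * (c * h (z(j := s j)))"
      using insert by simp
    also have "\<dots> \<le> c ^ card J * h z" using 2 c by (intro mult_left_mono) auto
    also have "\<dots> \<le> h (\<lambda>_. 0)" using insert.IH unfolding z_def by simp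
    finally show ?case using 3 unfolding z' by simp
  qed simp
  have "h (\<lambda>_. 0) = M - f P" by (simp add: h_def rank_one_pencil_def)
  then show "\<theta> * (M - f P) \<le> M - f (rank_one_pencil v P s)"
    and "\<theta> * (M - f (rank_one_pencil v P s)) \<le> M - f P"
    using walk[OF finite_class.finite_UNIV] by (simp_all add: \<theta>_def c_def h_def)
qed

lemma transpose_add: "transpose (A + B) = transpose A + transpose (B::real^'n^'m)"
  by (simp add: vec_eq_iff transpose_def)

lemma transpose_sum: "transpose (\<Sum>k\<in>K. A k) = (\<Sum>k\<in>K. transpose (A k :: real^'n^'m))"
  by (simp add: vec_eq_iff transpose_def)

lemma sum_matrix_vector: "(\<Sum>k\<in>K. A k :: real^'n^'m) *v x = (\<Sum>k\<in>K. A k *v x)"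
  by (induction K rule: infinite_finite_induct) (auto simp: matrix_vector_mult_add_rdistrib)

text \<open>Positive definiteness is an open condition: the perturbation changes the quadratic form at \<open>x\<close> by
at most \<open>e (\<Sum>\<^sub>k |v\<^sub>k|\<^sup>2) |x|\<^sup>2\<close>.\<close>

lemma pos_def_rank_one_pencil:
  fixes v :: "'k::finite \<Rightarrow> real^'q"
  assumes P: "pos_def P"
  obtains e where "e > 0" "\<And>s. (\<And>k. \<bar>s k\<bar> \<le> e) \<Longrightarrow> pos_def (rank_one_pencil v P s)"
proof -
  obtain l where l: "l > 0" "\<And>x. l * (norm x)\<^sup>2 \<le> x \<bullet> (P *v x)"
    using pos_def_lower_bound[OF P] by metis
  define V where "V = (\<Sum>k\<in>UNIV. (norm (v k))\<^sup>2)"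
  have V: "V \<ge> 0" unfolding V_def by (intro sum_nonneg) auto
  define e where "e = l / (V + 1)"
  have e: "e > 0" using l V by (simp add: e_def)
  have "pos_def (rank_one_pencil v P s)" if s: "\<And>k. \<bar>s k\<bar> \<le> e" for s
    unfolding pos_def_def
  proof (intro conjI allI impI)
    show "transpose (rank_one_pencil v P s) = rank_one_pencil v P s"
      using P by (simp add: rank_one_pencil_def transpose_add transpose_sum transpose_scalar pos_def_def)
    fix x :: "real^'q" assume x: "x \<noteq> 0"
    have "x \<bullet> (rank_one_pencil v P s *v x) = x \<bullet> (P *v x) + (\<Sum>k\<in>UNIV. s k * (v k \<bullet> x)\<^sup>2)"
      by (simp add: rank_one_pencil_def matrix_vector_mult_add_rdistrib sum_matrix_vector
          inner_right_distrib inner_sum_right scaleR_matrix_vector_assoc[symmetric]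
          outer_mult_vector power2_eq_square inner_commute mult.assoc)
    moreover have "(\<Sum>k\<in>UNIV. - (e * ((norm (v k))\<^sup>2 * (norm x)\<^sup>2))) \<le> (\<Sum>k\<in>UNIV. s k * (v k \<bullet> x)\<^sup>2)"
    proof (intro sum_mono)
      fix k
      have "(v k \<bullet> x)\<^sup>2 \<le> (norm (v k) * norm x)\<^sup>2"
        using Cauchy_Schwarz_ineq2[of "v k" x] by (metis abs_ge_zero power2_abs power_mono)
      then have "\<bar>s k * (v k \<bullet> x)\<^sup>2\<bar> \<le> e * ((norm (v k))\<^sup>2 * (norm x)\<^sup>2)"
        unfolding abs_mult using s[of k] e by (intro mult_mono) (auto simp: power_mult_distrib)
      then show "- (e * ((norm (v k))\<^sup>2 * (norm x)\<^sup>2)) \<le> s k * (v k \<bullet> x)\<^sup>2" by linarith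
    qed
    moreover have "(\<Sum>k\<in>UNIV. - (e * ((norm (v k))\<^sup>2 * (norm x)\<^sup>2))) = - (e * V * (norm x)\<^sup>2)"
      by (simp add: V_def sum_negf sum_distrib_left sum_distrib_right mult.assoc)
    moreover have "e * V * (norm x)\<^sup>2 < l * (norm x)\<^sup>2"
      using x l V by (intro mult_strict_right_mono) (auto simp: e_def field_simps)
    ultimately show "0 < x \<bullet> (rank_one_pencil v P s *v x)" using l(2)[of x] by linarith
  qed
  with e show thesis by (rule that)
qed

text \<open>The vectors \<open>e\<^sub>i + e\<^sub>j\<close> and \<open>e\<^sub>i - e\<^sub>j\<close>, as in the polarization identity
\<open>2(e\<^sub>i e\<^sub>j\<^sup>T + e\<^sub>j e\<^sub>i\<^sup>T) = (e\<^sub>i + e\<^sub>j)(e\<^sub>i + e\<^sub>j)\<^sup>T - (e\<^sub>i - e\<^sub>j)(e\<^sub>i - e\<^sub>j)\<^sup>T\<close>. The pairs with \<open>i = j\<close> and the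
redundant orders are kept, since this gives one formula for all entries.\<close>

definition polar_vector :: "'q \<times> 'q \<times> bool \<Rightarrow> real^'q" where
  "polar_vector = (\<lambda>(i, j, b). axis i 1 + (if b then 1 else -1) *\<^sub>R axis j 1)"

text \<open>The rank-one matrices of these vectors span the symmetric matrices, with coefficients that are small
if the matrix is small.\<close>

lemma symmetric_matrix_polarization:
  fixes A :: "real^'q^'q"
  assumes "transpose A = A"
  shows "A = (\<Sum>k\<in>UNIV. (case k of (i, j, b) \<Rightarrow> (if b then 1 else -1) * A $ i $ j / 4) *\<^sub>R
    outer (polar_vector k) (polar_vector k))"
proof -
  have sym: "A $ q $ p = A $ p $ q" for p q
    using arg_cong[OF assms, of "\<lambda>B. B $ p $ q"] by (simp add: transpose_def)
  have single: "(\<Sum>i\<in>UNIV. \<Sum>j\<in>UNIV. if i = p then if j = q then A $ i $ j / 2 else 0 else 0) = A $ p $ q / 2"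
    for p q
  proof -
    have "(\<Sum>j\<in>UNIV. if i = p then if j = q then A $ i $ j / 2 else 0 else 0)
        = (if i = p then A $ i $ q / 2 else 0)" for i by simp
    then show ?thesis by simp
  qed
  have "(\<Sum>k\<in>UNIV. (case k of (i, j, b) \<Rightarrow> (if b then 1 else -1) * A $ i $ j / 4) *
      (polar_vector k $ p * polar_vector k $ q)) = A $ p $ q" for p q
  proof -
    have "(\<Sum>k\<in>UNIV. (case k of (i, j, b) \<Rightarrow> (if b then 1 else -1) * A $ i $ j / 4) *
        (polar_vector k $ p * polar_vector k $ q))
      = (\<Sum>i\<in>UNIV. \<Sum>j\<in>UNIV. \<Sum>b\<in>UNIV. ((if b then 1 else -1) * A $ i $ j / 4) *
        (polar_vector (i, j, b) $ p * polar_vector (i, j, b) $ q))"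
      by (simp only: UNIV_Times_UNIV[symmetric] sum.cartesian_product' prod.case)
    also have "\<dots> = (\<Sum>i\<in>UNIV. \<Sum>j\<in>UNIV. A $ i $ j / 2 *
        ((if i = p then 1 else 0) * (if j = q then 1 else 0) + (if j = p then 1 else 0) * (if i = q then 1 else 0)))"
      by (intro sum.cong refl)
        (auto simp: UNIV_bool polar_vector_def axis_def algebra_simps)
    also have "\<dots> = (\<Sum>i\<in>UNIV. \<Sum>j\<in>UNIV. if i = p then if j = q then A $ i $ j / 2 else 0 else 0)
        + (\<Sum>i\<in>UNIV. \<Sum>j\<in>UNIV. if i = q then if j = p then A $ i $ j / 2 else 0 else 0)"
      unfolding sum.distrib[symmetric] by (intro sum.cong refl) auto
    also have "\<dots> = A $ p $ q / 2 + A $ q $ p / 2"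
      unfolding single ..
    finally show ?thesis by (simp add: sym[of q p])
  qed
  then show ?thesis by (simp add: vec_eq_iff outer_def)
qed

text \<open>Let \<open>f \<le> M\<close> on a cube around \<open>P\<close>, put \<open>H = M - f P \<ge> 0\<close> and \<open>\<theta> = (1 - 1/m)\<^sup>N\<close>, where \<open>N\<close> is the
number of coordinates. Near \<open>P\<close>, the value \<open>M - f Q\<close> lies between \<open>\<theta>H\<close> and \<open>H/\<theta>\<close>, and \<open>\<theta>\<close> is
arbitrarily close to \<open>1\<close> for large \<open>m\<close>.\<close>

theorem g_convex_continuous_on:
  fixes f :: "real^'q^'q \<Rightarrow> real"
  assumes f: "g_convex f"
  shows "continuous_on {A. pos_def A} f"
proof -
  have "\<exists>d>0. \<forall>Q\<in>{A. pos_def A}. dist Q P < d \<longrightarrow> dist (f Q) (f P) < \<epsilon>"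
    if P: "pos_def P" and \<epsilon>: "\<epsilon> > 0" for P \<epsilon>
  proof -
    let ?v = "polar_vector :: 'q \<times> 'q \<times> bool \<Rightarrow> real^'q"
    let ?N = "CARD('q \<times> 'q \<times> bool)"
    obtain e2 where e2: "e2 > 0" "\<And>s. (\<And>k. \<bar>s k\<bar> \<le> e2) \<Longrightarrow> pos_def (rank_one_pencil ?v P s)"
      using pos_def_rank_one_pencil[OF P, of ?v] by metis
    define e where "e = e2 / 2"
    have e: "e > 0" and pd: "\<And>s. (\<And>k. \<bar>s k\<bar> \<le> 2 * e) \<Longrightarrow> pos_def (rank_one_pencil ?v P s)"
      using e2 by (auto simp: e_def)
    obtain M where M: "\<And>s. (\<And>k. \<bar>s k\<bar> \<le> 2 * e) \<Longrightarrow> f (rank_one_pencil ?v P s) \<le> M"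
      using g_convex_bounded_on_pencil[OF f _ pd] e by (metis less_imp_le mult_pos_pos zero_less_numeral)
    define H where "H = M - f P"
    have H: "H \<ge> 0" using M[of "\<lambda>_. 0"] e by (simp add: H_def rank_one_pencil_def)
    have "(\<lambda>m. H / (1 - 1 / real m) ^ ?N) \<longlonglongrightarrow> H / (1 - 0) ^ ?N"
      by (intro tendsto_intros lim_1_over_n) auto
    then have "eventually (\<lambda>m. H / (1 - 1 / real m) ^ ?N < H + \<epsilon>) sequentially"
      using \<epsilon> by (intro order_tendstoD(2)) auto
    then have "eventually (\<lambda>m. H / (1 - 1 / real m) ^ ?N < H + \<epsilon> \<and> m \<ge> 2) sequentially"
      using eventually_ge_at_top by (rule eventually_conj)
    then obtain m :: nat where m: "H / (1 - 1 / real m) ^ ?N < H + \<epsilon>" "m \<ge> 2"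
      by (auto simp: eventually_sequentially)
    define \<theta> where "\<theta> = (1 - 1 / real m) ^ ?N"
    have \<theta>: "0 < \<theta>" "\<theta> \<le> 1" using m by (auto simp: \<theta>_def intro: power_le_one)
    define d where "d = e / (real m * 2 ^ m)"
    have d: "d > 0" using e m by (simp add: d_def)
    have "dist (f Q) (f P) < \<epsilon>" if Q: "pos_def Q" "dist Q P < d" for Q
    proof -
      define s where "s = (\<lambda>(i, j, b). (if b then 1 else -1) * (Q - P) $ i $ j / 4)"
      have "transpose (Q - P) = Q - P"
        using P Q by (simp add: pos_def_def vec_eq_iff transpose_def)
      from symmetric_matrix_polarization[OF this] have "Q - P = (\<Sum>k\<in>UNIV. s k *\<^sub>R outer (?v k) (?v k))"
        unfolding s_def .
      then have sQ: "rank_one_pencil ?v P s = Q" by (simp add: rank_one_pencil_def algebra_simps)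
      have s: "\<bar>s k\<bar> \<le> e / (real m * 2 ^ m)" for k
      proof -
        obtain i j b where k: "k = (i, j, b)" by (cases k) auto
        have "\<bar>(Q - P) $ i $ j\<bar> \<le> norm (Q - P)"
          using component_le_norm_cart[of "(Q - P) $ i" j] Finite_Cartesian_Product.norm_nth_le[of "Q - P" i]
          by linarith
        moreover have "\<bar>s k\<bar> = \<bar>(Q - P) $ i $ j\<bar> / 4" by (simp add: k s_def abs_mult)
        ultimately have "\<bar>s k\<bar> \<le> norm (Q - P)" by linarith
        with Q(2) show ?thesis by (simp add: dist_norm d_def)
      qed
      have "m \<ge> 1" using m by simp
      note cmp = g_convex_pencil_comparison[where s = s, OF f e pd M this s, folded \<theta>_def, unfolded sQ, folded H_def]
      have up: "M - f Q \<le> H / \<theta>" using cmp(2) \<theta> by (simp add: field_simps)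
      \<comment> \<open>The lower bound \<open>\<theta>H\<close> is at least \<open>2H - H/\<theta>\<close>, so both bounds differ from \<open>H\<close> by at most
        \<open>H/\<theta> - H < \<epsilon>\<close>.\<close>
      have "H * (2 - 1 / \<theta>) \<le> H * \<theta>"
      proof (intro mult_left_mono H)
        have "0 \<le> (\<theta> - 1)\<^sup>2 / \<theta>" using \<theta> by simp
        also have "\<dots> = \<theta> - 2 + 1 / \<theta>" using \<theta> by (simp add: field_simps power2_eq_square)
        finally show "2 - 1 / \<theta> \<le> \<theta>" by simp
      qed
      with cmp(1) have low: "2 * H - H / \<theta> \<le> M - f Q" by (simp add: algebra_simps)
      have "H / \<theta> < H + \<epsilon>" using m(1) by (simp only: \<theta>_def)
      with up low have "\<bar>H - (M - f Q)\<bar> < \<epsilon>" by linarith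
      then show ?thesis by (simp add: H_def dist_real_def)
    qed
    with d show ?thesis by blast
  qed
  then show ?thesis unfolding continuous_on_iff by blast
qed

section \<open>Critical points of g-convex functions\<close>

text \<open>The chord of a convex function lies above its tangent: the difference quotients at \<open>A\<close> towards \<open>B\<close>
are at most \<open>F B - F A\<close>, hence so is their limit, which is nonnegative.\<close>

lemma critical_point_imp_minimizer:
  fixes F :: "real^'q^'q \<Rightarrow> real"
  assumes F: "g_convex F" and crit: "critical_point F A"
  shows "minimizer F A"
  unfolding minimizer_def
proof (intro conjI allI impI)
  show A: "pos_def A" using crit by (simp add: critical_point_def)
  fix B :: "real^'q^'q"
  assume B: "pos_def B"
  obtain D where D: "D \<ge> 0"
    and der: "((\<lambda>t. F (geodesic A B t)) has_real_derivative D) (at_right 0)"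
    using crit B unfolding critical_point_def by blast
  have lim: "((\<lambda>t. (F (geodesic A B t) - F A) / t) \<longlongrightarrow> D) (at_right 0)"
    using der by (simp add: has_field_derivative_iff geodesic_0[OF A B])
  have "eventually (\<lambda>t::real. 0 < t \<and> t < 1) (at_right 0)"
    using eventually_at_right_real[of 0 1] by (simp add: eventually_mono)
  then have "eventually (\<lambda>t. (F (geodesic A B t) - F A) / t \<le> F B - F A) (at_right 0)"
  proof eventually_elim
    case (elim t)
    then have "F (geodesic A B t) \<le> (1 - t) * F A + t * F B"
      using g_convexD[OF F A B, of t] by simp
    then have "F (geodesic A B t) - F A \<le> (F B - F A) * t" by (simp add: algebra_simps)
    then show ?case using elim by (simp add: pos_divide_le_eq)
  qed
  then have "D \<le> F B - F A" using lim by (intro tendsto_upperbound) auto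
  with D show "F A \<le> F B" by simp
qed

text \<open>For a convex function the difference quotients decrease as \<open>t\<close> tends to \<open>0\<close>; at a minimizer they
are nonnegative. So the one-sided derivative exists as their infimum.\<close>

lemma minimizer_imp_critical_point:
  fixes F :: "real^'q^'q \<Rightarrow> real"
  assumes F: "g_convex F" and min: "minimizer F A"
  shows "critical_point F A"
  unfolding critical_point_def
proof (intro conjI allI impI)
  show A: "pos_def A" using min by (simp add: minimizer_def)
  fix B :: "real^'q^'q"
  assume B: "pos_def B"
  define q where "q = (\<lambda>t. (F (geodesic A B t) - F A) / t)"
  have nonneg: "0 \<le> q t" if "t > 0" for t
    using min pos_def_geodesic[OF A B] that by (simp add: q_def minimizer_def)
  have mono: "q r \<le> q t" if rt: "0 < r" "r \<le> t" for r t
  proof -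
    have t: "0 < t" using rt by simp
    have "F (geodesic A B r) = F (geodesic A (geodesic A B t) (r / t))"
      using t by (simp add: geodesic_geodesic[OF A B])
    also have "\<dots> \<le> (1 - r / t) * F A + (r / t) * F (geodesic A B t)"
      using rt t by (intro g_convexD F A pos_def_geodesic B) auto
    finally have "F (geodesic A B r) - F A \<le> r * q t"
      using t by (simp add: q_def field_simps)
    then show ?thesis using rt by (simp add: q_def divide_le_eq mult.commute)
  qed
  define D where "D = Inf (q ` {0<..})"
  have lim: "(q \<longlongrightarrow> D) (at_right 0)"
    using Lim_right_bound[of UNIV 0 q 0] mono nonneg unfolding D_def by simp
  have "((\<lambda>t. F (geodesic A B t)) has_real_derivative D) (at_right 0)"
    using lim by (simp add: has_field_derivative_iff geodesic_0[OF A B] q_def)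
  moreover have "D \<ge> 0"
    unfolding D_def using nonneg by (intro cInf_greatest) auto
  ultimately show "\<exists>D\<ge>0. ((\<lambda>t. F (geodesic A B t)) has_real_derivative D) (at_right 0)" by blast
qed

section \<open>The unpenalized loss\<close>

text \<open>Up to constants, twice the average negative log-likelihood of a centred Gaussian sample with
covariance \<open>\<Sigma>\<close> and second-moment matrix \<open>S\<close>.\<close>

definition gauss_loss :: "real^'q^'q \<Rightarrow> real^'q^'q \<Rightarrow> real" where
  "gauss_loss S \<Sigma> = trace (matrix_inv \<Sigma> ** S) + ln (det \<Sigma>)"

lemma penalized_loss_eq: "penalized_loss pen S \<eta> \<Sigma> = gauss_loss S \<Sigma> + \<eta> * pen \<Sigma>"
  by (simp add: penalized_loss_def gauss_loss_def)

lemma matrix_inv_eqI: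
  fixes A B :: "real^'q^'q"
  assumes "A ** B = mat 1" "B ** A = mat 1"
  shows "matrix_inv A = B"
proof -
  have "A ** matrix_inv A = mat 1 \<and> matrix_inv A ** A = mat 1"
    unfolding matrix_inv_def by (rule someI[of _ B]) (use assms in simp)
  then have "matrix_inv A = matrix_inv A ** (A ** B)" "matrix_inv A ** A ** B = B"
    by (simp_all add: assms)
  then show ?thesis by (simp add: matrix_mul_assoc)
qed

text \<open>The inverse of \<open>T diag(d) T\<^sup>T\<close> is \<open>X\<^sup>T diag(1/d) X\<close>, so by cyclicity of the trace only the diagonal of
\<open>X S X\<^sup>T\<close> enters; its entries are the values of the quadratic form of \<open>S\<close> at the rows of \<open>X\<close>.\<close>

lemma gauss_loss_congr_diag:
  fixes T X S :: "real^'q^'q" and d :: "real^'q"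
  assumes TX: "T ** X = mat 1" "X ** T = mat 1" and d: "\<And>i. d $ i > 0"
  shows "gauss_loss S (congr_diag T d) =
    ln ((det T)\<^sup>2) + (\<Sum>i\<in>UNIV. (X $ i \<bullet> (S *v X $ i)) / d $ i + ln (d $ i))"
proof -
  define E where "E = diag_matrix (\<chi> i. 1 / d $ i)"
  have DE: "diag_matrix d ** E = mat 1" "E ** diag_matrix d = mat 1"
  proof -
    have "d $ i \<noteq> 0" for i using d[of i] by simp
    then show "diag_matrix d ** E = mat 1" "E ** diag_matrix d = mat 1"
      by (simp_all add: E_def diag_matrix_mult diag_matrix_one)
  qed
  have XT: "transpose T ** transpose X = mat 1" "transpose X ** transpose T = mat 1"
    by (simp_all add: matrix_transpose_mul[symmetric] TX)
  have "congr_diag T d ** (transpose X ** E ** X) = T ** (diag_matrix d ** ((transpose T ** transpose X) ** E)) ** X"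
    by (simp add: congr_diag_def matrix_mul_assoc)
  then have 1: "congr_diag T d ** (transpose X ** E ** X) = mat 1" by (simp add: XT DE TX)
  have inv: "matrix_inv (congr_diag T d) = transpose X ** E ** X"
    using 1 by (intro matrix_inv_eqI) (simp_all add: matrix_left_right_inverse)
  have "trace (transpose X ** E ** X ** S) = trace (E ** (X ** S ** transpose X))"
    using trace_mul_sym[of "transpose X" "E ** X ** S"] by (simp add: matrix_mul_assoc)
  also have "\<dots> = (\<Sum>i\<in>UNIV. (X $ i \<bullet> (S *v X $ i)) / d $ i)"
  proof -
    have "(E ** Y) $ i $ i = Y $ i $ i / d $ i" for Y :: "real^'q^'q" and i
      by (simp add: E_def diag_matrix_def matrix_matrix_mult_def if_distrib[of "\<lambda>x. x * _"] cong: if_cong)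
    moreover have "(X ** S ** transpose X) $ i $ i = X $ i \<bullet> (S *v X $ i)" for i
    proof -
      have "(X ** S ** transpose X) $ i $ i = (X ** (S ** transpose X)) $ i $ i"
        by (simp add: matrix_mul_assoc)
      then show ?thesis
        by (simp add: matrix_matrix_mult_def matrix_vector_mult_def inner_vec_def transpose_def)
    qed
    ultimately show ?thesis by (simp add: trace_def)
  qed
  finally have tr: "trace (matrix_inv (congr_diag T d) ** S) = (\<Sum>i\<in>UNIV. (X $ i \<bullet> (S *v X $ i)) / d $ i)"
    by (simp add: inv)
  have "det T \<noteq> 0" using TX by (metis det_I det_mul mult_zero_left zero_neq_one)
  moreover have "det (congr_diag T d) = (det T)\<^sup>2 * (\<Prod>i\<in>UNIV. d $ i)"
    by (simp add: congr_diag_def det_mul det_diag_matrix power2_eq_square)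
  ultimately have "ln (det (congr_diag T d)) = ln ((det T)\<^sup>2) + ln (\<Prod>i\<in>UNIV. d $ i)"
    using d by (simp add: ln_mult_pos prod_pos)
  also have "ln (\<Prod>i\<in>UNIV. d $ i) = (\<Sum>i\<in>UNIV. ln (d $ i))"
    by (rule ln_prod) (simp, metis d less_irrefl)
  finally show ?thesis by (simp add: gauss_loss_def tr sum.distrib)
qed

text \<open>The strict weighted inequality of the arithmetic and geometric means of \<open>1\<close> and \<open>y\<close>, with the
arithmetic mean \<open>m\<close>: apply \<open>ln x \<le> x - 1\<close> to \<open>1/m\<close> and \<open>y/m\<close>, whose weighted mean is \<open>1\<close>;
the inequality is strict at \<open>1/m \<noteq> 1\<close>.\<close>

lemma powr_less_weighted_mean:
  fixes y :: real
  assumes y: "y > 0" "y \<noteq> 1" and t: "0 < t" "t < 1"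
  shows "y powr t < 1 - t + t * y"
proof -
  define m where "m = 1 - t + t * y"
  have m: "m > 0" using y t by (simp add: m_def add_pos_pos)
  have "m \<noteq> 1" using y t by (simp add: m_def algebra_simps)
  then have "ln (1 / m) \<noteq> 1 / m - 1"
    using ln_eq_minus_one[of "1 / m"] m by auto
  then have "ln (1 / m) < 1 / m - 1" using ln_le_minus_one[of "1 / m"] m by simp
  then have "(1 - t) * ln (1 / m) < (1 - t) * (1 / m - 1)" using t by (intro mult_strict_left_mono) auto
  moreover have "t * ln (y / m) \<le> t * (y / m - 1)"
    using ln_le_minus_one[of "y / m"] m y t by (intro mult_left_mono) auto
  moreover have "(1 - t) * (1 / m - 1) + t * (y / m - 1) = 0"
    using m by (simp add: field_simps) (simp add: m_def algebra_simps)
  ultimately have "(1 - t) * ln (1 / m) + t * ln (y / m) < 0" by linarith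
  then have "t * ln y < ln m" using m y by (simp add: ln_div algebra_simps)
  then have "exp (t * ln y) < exp (ln m)" by simp
  also have "exp (ln m) = m" using m by simp
  finally show ?thesis using y by (simp add: powr_def m_def)
qed

text \<open>In simultaneously diagonal coordinates the logarithmic terms are linear in \<open>t\<close>, and the trace
contributes \<open>\<Sum>\<^sub>i c\<^sub>i (1/d\<^sub>i)\<^sup>t\<close> with \<open>c\<^sub>i > 0\<close>. Some \<open>d\<^sub>i\<close> differs from \<open>1\<close> because \<open>A \<noteq> B\<close>.\<close>

theorem gauss_loss_strictly_g_convex:
  fixes S :: "real^'q^'q"
  assumes S: "pos_def S" and A: "pos_def A" and B: "pos_def B" and ne: "A \<noteq> B" and t: "0 < t" "t < 1"
  shows "gauss_loss S (geodesic A B t) < (1 - t) * gauss_loss S A + t * gauss_loss S B"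
proof -
  obtain T d where T: "invertible T" and d: "\<And>i. d $ i > 0"
    and AT: "A = T ** transpose T" and BT: "B = congr_diag T d"
    using pos_def_simultaneous_diagonalization A B by metis
  obtain X where X: "T ** X = mat 1" "X ** T = mat 1" using T by (auto simp: invertible_def)
  define c where "c = (\<lambda>i. X $ i \<bullet> (S *v X $ i))"
  have c: "c i > 0" for i
  proof -
    have "X $ i \<noteq> 0"
    proof
      assume "X $ i = 0"
      then have "(X ** T) $ i $ i = 0" by (simp add: matrix_matrix_mult_def)
      then show False by (simp add: X mat_def)
    qed
    then show ?thesis using S by (simp add: c_def pos_def_def)
  qed
  define k where "k = ln ((det T)\<^sup>2)"
  have loss: "gauss_loss S (congr_diag T e) = k + (\<Sum>i\<in>UNIV. c i / e $ i + ln (e $ i))"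
    if "\<And>i. e $ i > 0" for e
    using gauss_loss_congr_diag[OF X that] by (simp add: k_def c_def)
  have lA: "gauss_loss S A = k + (\<Sum>i\<in>UNIV. c i)"
    using loss[of "\<chi> i. 1"] by (simp add: AT congr_diag_one)
  have lB: "gauss_loss S B = k + (\<Sum>i\<in>UNIV. c i / d $ i + ln (d $ i))"
    using loss[OF d] by (simp add: BT)
  have "geodesic A B t = congr_diag T (\<chi> i. (d $ i) powr t)"
    by (simp add: AT BT geodesic_congr_diag[OF T])
  then have lt: "gauss_loss S (geodesic A B t) = k + (\<Sum>i\<in>UNIV. c i * (1 / d $ i) powr t + t * ln (d $ i))"
    using loss[of "\<chi> i. (d $ i) powr t"] d
    by (simp add: less_imp_neq[symmetric] powr_divide less_imp_le ln_powr)
  have le: "(1 / d $ i) powr t \<le> 1 - t + t * (1 / d $ i)" for i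
    using powr_less_weighted_mean[of "1 / d $ i" t] d[of i] t by (cases "d $ i = 1") auto
  obtain i where i: "d $ i \<noteq> 1"
  proof (rule ccontr)
    assume "\<not> thesis"
    then have "d = (\<chi> i. 1)" using that by (auto simp: vec_eq_iff)
    then show False using ne by (simp add: AT BT congr_diag_one)
  qed
  have "(\<Sum>i\<in>UNIV. c i * (1 / d $ i) powr t + t * ln (d $ i))
      < (\<Sum>i\<in>UNIV. c i * (1 - t + t * (1 / d $ i)) + t * ln (d $ i))"
  proof (rule sum_strict_mono_ex1)
    show "\<forall>i\<in>UNIV. c i * (1 / d $ i) powr t + t * ln (d $ i) \<le> c i * (1 - t + t * (1 / d $ i)) + t * ln (d $ i)"
      using le c by (auto intro!: mult_left_mono simp: less_imp_le)
    have "(1 / d $ i) powr t < 1 - t + t * (1 / d $ i)"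
      using i d[of i] t by (intro powr_less_weighted_mean) auto
    then show "\<exists>i\<in>UNIV. c i * (1 / d $ i) powr t + t * ln (d $ i) < c i * (1 - t + t * (1 / d $ i)) + t * ln (d $ i)"
      using c by (intro bexI[of _ i]) auto
  qed simp
  also have "\<dots> = (1 - t) * (\<Sum>i\<in>UNIV. c i) + t * (\<Sum>i\<in>UNIV. c i / d $ i + ln (d $ i))"
    unfolding sum_distrib_left sum.distrib[symmetric]
    by (intro sum.cong refl) (simp add: algebra_simps)
  finally show ?thesis unfolding lA lB lt by (simp add: algebra_simps)
qed

lemma g_convex_gauss_loss:
  fixes S :: "real^'q^'q"
  assumes "pos_def S"
  shows "g_convex (gauss_loss S)"
  unfolding g_convex_def
proof (intro allI impI)
  fix A B :: "real^'q^'q" and t :: real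
  assume AB: "pos_def A" "pos_def B" and t: "0 < t" "t < 1"
  show "gauss_loss S (geodesic A B t) \<le> (1 - t) * gauss_loss S A + t * gauss_loss S B"
  proof (cases "A = B")
    case True
    have "geodesic A A t = geodesic A (geodesic A A 0) t" using AB by (simp add: geodesic_0)
    also have "\<dots> = A" using AB by (subst geodesic_geodesic) (auto simp: geodesic_0)
    finally show ?thesis using True by (simp add: algebra_simps)
  next
    case False
    then show ?thesis using gauss_loss_strictly_g_convex[OF assms AB _ t] by simp
  qed
qed

text \<open>The function \<open>l/d + ln d\<close> tends to infinity at both ends of \<open>(0, \<infinity>)\<close>: at infinity by the logarithm,
and at \<open>0\<close> because half of \<open>l/d\<close> already compensates the logarithm.\<close>

lemma div_plus_ln_sublevel_bounds:
  fixes l b :: real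
  assumes l: "l > 0"
  obtains m M where "m > 0" "\<And>d. d > 0 \<Longrightarrow> l / d + ln d \<le> b \<Longrightarrow> m \<le> d \<and> d \<le> M"
proof -
  define B where "B = \<bar>b - 1 - ln (l / 2)\<bar> + 1"
  have B: "B > 0" by (simp add: B_def)
  have "l / (2 * B) \<le> d \<and> d \<le> exp b" if d: "d > 0" "l / d + ln d \<le> b" for d
  proof
    have "ln (l / 2 / d) \<le> l / 2 / d - 1" using l d by (intro ln_le_minus_one) auto
    moreover have "ln (l / 2 / d) = ln (l / 2) - ln d" using l d by (simp only: ln_divide_pos half_gt_zero)
    ultimately have "ln (l / 2) - ln d \<le> l / d / 2 - 1" by (simp add: mult.commute)
    then have "l / d / 2 \<le> b - 1 - ln (l / 2)" using d(2) by linarith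
    then have "l / d / 2 \<le> B" by (simp add: B_def)
    then show "l / (2 * B) \<le> d" using d B by (simp add: field_simps)
    have "0 < l / d" using l d by simp
    then have "ln d \<le> b" using d(2) by linarith
    then have "exp (ln d) \<le> exp b" by simp
    then show "d \<le> exp b" using d by simp
  qed
  moreover have "l / (2 * B) > 0" using l B by simp
  ultimately show thesis by (rule that[rotated])
qed

text \<open>The norm of a matrix, as a vector of rows, is the Frobenius norm, and
\<open>|A|\<^sup>2 = tr(AA\<^sup>T)\<close> does not change when \<open>A\<close> is conjugated by an orthogonal matrix.\<close>

lemma norm_congr_diag_orthogonal:
  fixes P :: "real^'q^'q"
  assumes P: "orthogonal_matrix P"
  shows "(norm (congr_diag P d))\<^sup>2 = (\<Sum>i\<in>UNIV. (d $ i)\<^sup>2)"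
proof -
  let ?A = "congr_diag P d"
  have "(norm ?A)\<^sup>2 = trace (?A ** transpose ?A)"
    unfolding power2_norm_eq_inner
    by (simp add: trace_def matrix_matrix_mult_def inner_vec_def transpose_def)
  also have "\<dots> = trace (congr_diag P (\<chi> i. d $ i * d $ i))"
    by (simp add: congr_diag_orthogonal_mult[OF P])
  also have "\<dots> = trace (diag_matrix (\<chi> i. d $ i * d $ i) ** (transpose P ** P))"
    unfolding congr_diag_def
    using trace_mul_sym[of P "diag_matrix (\<chi> i. d $ i * d $ i) ** transpose P"]
    by (simp add: matrix_mul_assoc)
  also have "\<dots> = (\<Sum>i\<in>UNIV. (d $ i)\<^sup>2)"
    using P by (simp add: orthogonal_matrix_def trace_def diag_matrix_def power2_eq_square)
  finally show ?thesis .
qed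

lemma compact_pos_def_bounds:
  fixes m R :: real
  assumes m: "m > 0"
  defines "K \<equiv> {A :: real^'q^'q. transpose A = A \<and> norm A \<le> R \<and> (\<forall>v. m * (norm v)\<^sup>2 \<le> v \<bullet> (A *v v))}"
  shows "compact K" "K \<subseteq> {A. pos_def A}"
proof -
  have lin: "linear (\<lambda>A :: real^'q^'q. A *v v)" for v
    by (intro linearI) (simp_all add: matrix_vector_mult_add_rdistrib scaleR_matrix_vector_assoc)
  have cont: "continuous_on UNIV (\<lambda>A :: real^'q^'q. A *v v)" for v
    by (rule linear_continuous_on) (use lin in \<open>simp add: linear_conv_bounded_linear\<close>)
  have K: "K = {A. \<forall>i j. A $ j $ i = A $ i $ j} \<inter> cball 0 R \<inter> {A. \<forall>v. m * (norm v)\<^sup>2 \<le> v \<bullet> (A *v v)}"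
    unfolding K_def by (auto simp: vec_eq_iff transpose_def)
  have "closed {A :: real^'q^'q. \<forall>i j. A $ j $ i = A $ i $ j}"
    by (intro closed_Collect_all closed_Collect_eq continuous_intros)
  moreover have "closed {A :: real^'q^'q. \<forall>v. m * (norm v)\<^sup>2 \<le> v \<bullet> (A *v v)}"
    by (intro closed_Collect_all closed_Collect_le continuous_intros cont)
  ultimately show "compact K"
    unfolding K by (intro compact_Int_closed closed_Int_compact compact_cball)
  show "K \<subseteq> {A. pos_def A}"
  proof
    fix A assume A: "A \<in> K"
    have "0 < v \<bullet> (A *v v)" if "v \<noteq> 0" for v
    proof -
      have "0 < m * (norm v)\<^sup>2" using m that by simp
      also have "\<dots> \<le> v \<bullet> (A *v v)" using A by (simp add: K_def)
      finally show ?thesis .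
    qed
    then show "A \<in> {A. pos_def A}" using A by (simp add: pos_def_def K_def)
  qed
qed

text \<open>In a spectral decomposition of \<open>A\<close> with eigenvalues \<open>d\<^sub>i\<close>, the loss is a sum of terms that are at
least \<open>l/d\<^sub>i + ln d\<^sub>i\<close>, and each of these is at least \<open>1 + ln l\<close>. So a bound on the sum bounds every
single term, which confines all eigenvalues to an interval \<open>[m, M]\<close> with \<open>m > 0\<close>.\<close>

theorem gauss_loss_coercive:
  fixes S :: "real^'q^'q"
  assumes S: "pos_def S"
  obtains K where "compact K" "K \<subseteq> {A. pos_def A}" "\<And>A. pos_def A \<Longrightarrow> gauss_loss S A \<le> c \<Longrightarrow> A \<in> K"
proof -
  obtain l where l: "l > 0" and lS: "\<And>v. l * (norm v)\<^sup>2 \<le> v \<bullet> (S *v v)"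
    using pos_def_lower_bound[OF S] by metis
  \<comment> \<open>A bound for a single term \<open>l/d\<^sub>i + ln d\<^sub>i\<close>: the others are at least \<open>1 + ln l\<close> each.\<close>
  define b where "b = c - (real CARD('q) - 1) * (1 + ln l)"
  obtain m M where m: "m > 0" and mM: "\<And>d. d > 0 \<Longrightarrow> l / d + ln d \<le> b \<Longrightarrow> m \<le> d \<and> d \<le> M"
    using div_plus_ln_sublevel_bounds[OF l, of b] by metis
  define R where "R = sqrt (real CARD('q) * M\<^sup>2)"
  define K where "K = {A :: real^'q^'q. transpose A = A \<and> norm A \<le> R \<and> (\<forall>v. m * (norm v)\<^sup>2 \<le> v \<bullet> (A *v v))}"
  have "A \<in> K" if A: "pos_def A" and le: "gauss_loss S A \<le> c" for A
  proof -
    obtain P d where P: "orthogonal_matrix P" and AP: "A = congr_diag P d"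
      using symmetric_matrix_spectral A unfolding pos_def_def by blast
    have d: "d $ i > 0" for i
      using A AP pos_def_congr_diag[OF orthogonal_imp_invertible[OF P]] by simp
    have PT: "P ** transpose P = mat 1" "transpose P ** P = mat 1"
      using P by (simp_all add: orthogonal_matrix_def)
    define Q where "Q = transpose P"
    have row: "norm (Q $ i) = 1" for i
    proof -
      have "norm (row i Q) = 1"
        using P orthogonal_matrix_orthonormal_rows[of Q] by (simp add: Q_def)
      then show ?thesis by (simp add: row_def)
    qed
    have "ln ((det P)\<^sup>2) = 0"
      using det_orthogonal_matrix[OF P] by auto
    then have "gauss_loss S A = (\<Sum>i\<in>UNIV. (Q $ i \<bullet> (S *v Q $ i)) / d $ i + ln (d $ i))"
      unfolding AP Q_def using gauss_loss_congr_diag[OF PT d] by simp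
    moreover have "l / d $ i \<le> (Q $ i \<bullet> (S *v Q $ i)) / d $ i" for i
      using lS[of "Q $ i"] d[of i] by (intro divide_right_mono) (simp_all add: row less_imp_le)
    ultimately have sum: "(\<Sum>i\<in>UNIV. l / d $ i + ln (d $ i)) \<le> c"
      using le by (smt (verit) sum_mono)
    have low: "1 + ln l \<le> l / d $ i + ln (d $ i)" for i
      using ln_le_minus_one[of "l / d $ i"] l d[of i] by (simp add: ln_div)
    have md: "m \<le> d $ i \<and> d $ i \<le> M" for i
    proof (rule mM[OF d])
      have "(\<Sum>j\<in>UNIV. l / d $ j + ln (d $ j))
          = l / d $ i + ln (d $ i) + (\<Sum>j\<in>UNIV - {i}. l / d $ j + ln (d $ j))"
        by (simp add: sum.remove[of UNIV i])
      moreover have "(\<Sum>j\<in>UNIV - {i}. 1 + ln l) \<le> (\<Sum>j\<in>UNIV - {i}. l / d $ j + ln (d $ j))"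
        by (intro sum_mono low)
      moreover have "(\<Sum>j\<in>UNIV - {i}. 1 + ln l) = (real CARD('q) - 1) * (1 + ln l)"
        by (simp add: card_Diff_singleton of_nat_diff Suc_leI)
      ultimately show "l / d $ i + ln (d $ i) \<le> b" using sum by (simp add: b_def)
    qed
    have "norm A \<le> R"
    proof -
      have "(norm A)\<^sup>2 = (\<Sum>i\<in>UNIV. (d $ i)\<^sup>2)"
        unfolding AP by (rule norm_congr_diag_orthogonal[OF P])
      also have "\<dots> \<le> (\<Sum>i\<in>(UNIV::'q set). M\<^sup>2)"
        using md d by (intro sum_mono power_mono) (auto simp: less_imp_le)
      finally show ?thesis unfolding R_def by (simp add: real_le_rsqrt)
    qed
    moreover have "m * (norm v)\<^sup>2 \<le> v \<bullet> (A *v v)" for v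
    proof -
      have "(norm v)\<^sup>2 = v \<bullet> (congr_diag P (\<chi> i. 1) *v v)"
        by (simp add: congr_diag_one PT power2_norm_eq_inner)
      then have "(norm v)\<^sup>2 = (\<Sum>i\<in>UNIV. ((v v* P) $ i)\<^sup>2)"
        by (simp add: congr_diag_quadratic_form)
      then have "m * (norm v)\<^sup>2 = (\<Sum>i\<in>UNIV. m * ((v v* P) $ i)\<^sup>2)"
        by (simp add: sum_distrib_left)
      also have "\<dots> \<le> (\<Sum>i\<in>UNIV. d $ i * ((v v* P) $ i)\<^sup>2)"
        using md by (intro sum_mono mult_right_mono) auto
      finally show ?thesis by (simp add: AP congr_diag_quadratic_form)
    qed
    ultimately show ?thesis using A by (simp add: K_def pos_def_def)
  qed
  moreover have "compact K" "K \<subseteq> {A. pos_def A}"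
    unfolding K_def by (rule compact_pos_def_bounds[OF m])+
  ultimately show thesis using that by blast
qed

section \<open>The penalized loss\<close>

lemma pos_def_mat_1: "pos_def (mat 1 :: real^'q^'q)"
  by (simp add: pos_def_def)

lemma g_convex_penalized_loss:
  fixes pen :: "real^'q^'q \<Rightarrow> real"
  assumes S: "pos_def S" and pen: "g_convex pen" and \<eta>: "\<eta> \<ge> 0"
  shows "g_convex (penalized_loss pen S \<eta>)"
  unfolding g_convex_def penalized_loss_eq
proof (intro allI impI)
  fix A B :: "real^'q^'q" and t :: real
  assume AB: "pos_def A" "pos_def B" and t: "0 < t" "t < 1"
  have "\<eta> * pen (geodesic A B t) \<le> \<eta> * ((1 - t) * pen A + t * pen B)"
    using pen AB t \<eta> unfolding g_convex_def by (intro mult_left_mono) auto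
  moreover have "gauss_loss S (geodesic A B t) \<le> (1 - t) * gauss_loss S A + t * gauss_loss S B"
    using g_convex_gauss_loss[OF S] AB t unfolding g_convex_def by auto
  ultimately show "gauss_loss S (geodesic A B t) + \<eta> * pen (geodesic A B t)
      \<le> (1 - t) * (gauss_loss S A + \<eta> * pen A) + t * (gauss_loss S B + \<eta> * pen B)"
    by (simp add: algebra_simps)
qed

text \<open>At the midpoint of the geodesic between two distinct minimizers the loss would be smaller.\<close>

lemma minimizer_penalized_loss_unique:
  fixes pen :: "real^'q^'q \<Rightarrow> real"
  assumes S: "pos_def S" and pen: "g_convex pen" and \<eta>: "\<eta> \<ge> 0"
    and A: "minimizer (penalized_loss pen S \<eta>) A" and B: "minimizer (penalized_loss pen S \<eta>) B"
  shows "A = B"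
proof (rule ccontr)
  assume ne: "A \<noteq> B"
  let ?L = "penalized_loss pen S \<eta>"
  have pd: "pos_def A" "pos_def B" using A B by (simp_all add: minimizer_def)
  let ?C = "geodesic A B (1/2)"
  have "\<eta> * pen ?C \<le> \<eta> * ((1 - 1/2) * pen A + 1/2 * pen B)"
    using \<eta> by (intro mult_left_mono g_convexD pen pd) auto
  with gauss_loss_strictly_g_convex[OF S pd ne, of "1/2"]
  have "?L ?C < (?L A + ?L B) / 2" by (simp add: penalized_loss_eq algebra_simps)
  moreover have "?L A \<le> ?L ?C" "?L B \<le> ?L ?C"
    using A B pos_def_geodesic[OF pd] by (simp_all add: minimizer_def)
  ultimately show False by simp
qed

text \<open>Outside a suitable compact set the loss exceeds its value at the identity matrix, so it is enough to
minimize the continuous loss on this set.\<close>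

lemma minimizer_penalized_loss_exists:
  fixes pen :: "real^'q^'q \<Rightarrow> real"
  assumes S: "pos_def S" and pen: "g_convex pen" and nonneg: "\<And>\<Sigma>. pos_def \<Sigma> \<Longrightarrow> 0 \<le> pen \<Sigma>"
    and \<eta>: "\<eta> \<ge> 0"
  shows "\<exists>A. minimizer (penalized_loss pen S \<eta>) A"
proof -
  let ?L = "penalized_loss pen S \<eta>"
  obtain K where K: "compact K" "K \<subseteq> {A. pos_def A}"
    and sub: "\<And>A. pos_def A \<Longrightarrow> gauss_loss S A \<le> ?L (mat 1) \<Longrightarrow> A \<in> K"
    using gauss_loss_coercive[OF S, of "?L (mat 1)"] by metis
  have le: "gauss_loss S A \<le> ?L A" if "pos_def A" for A
    using nonneg[OF that] \<eta> by (simp add: penalized_loss_eq)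
  have I: "mat 1 \<in> K" by (intro sub pos_def_mat_1 le)
  have "continuous_on K ?L"
    using g_convex_continuous_on[OF g_convex_penalized_loss[OF S pen \<eta>]] K(2)
    by (rule continuous_on_subset)
  then obtain A where A: "A \<in> K" "\<And>B. B \<in> K \<Longrightarrow> ?L A \<le> ?L B"
    using continuous_attains_inf[OF K(1)] I by (metis empty_iff)
  have "?L A \<le> ?L B" if B: "pos_def B" for B
  proof (cases "B \<in> K")
    case False
    then have "?L (mat 1) < gauss_loss S B" using sub[OF B] by force
    then show ?thesis using A(2)[OF I] le[OF B] by linarith
  qed (rule A)
  then show ?thesis using A(1) K(2) by (auto simp: minimizer_def)
qed

text \<open>For \<open>\<eta> \<le> E\<close>, the minimizers have unpenalized loss at most \<open>L(I; E)\<close>, since \<open>pen \<ge> 0\<close>; so they lie in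
one compact set \<open>K\<close>. A map into a compact set is continuous if its graph is closed, and by
uniqueness the graph consists of the pairs \<open>(\<eta>, A)\<close> that satisfy the closed conditions
\<open>L(A; \<eta>) \<le> L(B; \<eta>)\<close> for all positive definite \<open>B\<close>.\<close>

lemma minimizer_penalized_loss_continuous:
  fixes pen :: "real^'q^'q \<Rightarrow> real"
  assumes S: "pos_def S" and pen: "g_convex pen" and nonneg: "\<And>\<Sigma>. pos_def \<Sigma> \<Longrightarrow> 0 \<le> pen \<Sigma>"
    and h: "\<And>\<eta>. \<eta> \<ge> 0 \<Longrightarrow> minimizer (penalized_loss pen S \<eta>) (h \<eta>)"
  shows "continuous_on {0..} h"
proof -
  have bounded: "continuous_on {0..E} h" if E: "E \<ge> 0" for E
  proof -
    let ?c = "gauss_loss S (mat 1) + E * pen (mat 1)"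
    obtain K where K: "compact K" "K \<subseteq> {A. pos_def A}"
      and sub: "\<And>A. pos_def A \<Longrightarrow> gauss_loss S A \<le> ?c \<Longrightarrow> A \<in> K"
      using gauss_loss_coercive[OF S, of ?c] by metis
    have hK: "h \<eta> \<in> K" if \<eta>: "\<eta> \<in> {0..E}" for \<eta>
    proof (rule sub)
      have min: "minimizer (penalized_loss pen S \<eta>) (h \<eta>)" using h \<eta> by simp
      then show pd: "pos_def (h \<eta>)" by (simp add: minimizer_def)
      have "gauss_loss S (h \<eta>) \<le> penalized_loss pen S \<eta> (h \<eta>)"
        using nonneg[OF pd] \<eta> by (simp add: penalized_loss_eq)
      also have "\<dots> \<le> penalized_loss pen S \<eta> (mat 1)"
        using min pos_def_mat_1 by (auto simp: minimizer_def)
      also have "\<dots> \<le> ?c"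
        using \<eta> nonneg[OF pos_def_mat_1] by (simp add: penalized_loss_eq mult_right_mono)
      finally show "gauss_loss S (h \<eta>) \<le> ?c" .
    qed
    have cont: "continuous_on ({0..E} \<times> K) (\<lambda>z. penalized_loss pen S (fst z) (snd z))"
    proof -
      have "continuous_on ({0..E} \<times> K) (\<lambda>z. f (snd z))" if "g_convex f" for f :: "real^'q^'q \<Rightarrow> real"
        by (rule continuous_on_compose2[OF g_convex_continuous_on[OF that]])
          (use K(2) in \<open>auto intro: continuous_intros\<close>)
      then show ?thesis
        unfolding penalized_loss_eq using pen g_convex_gauss_loss[OF S] by (intro continuous_intros)
    qed
    have "(\<lambda>\<eta>. (\<eta>, h \<eta>)) ` {0..E} = (\<Inter>B\<in>{B. pos_def B}.
        {z \<in> {0..E} \<times> K. penalized_loss pen S (fst z) (snd z) \<le> penalized_loss pen S (fst z) B})"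
      (is "?G = ?H")
    proof
      show "?G \<subseteq> ?H" using hK h by (auto simp: minimizer_def)
      show "?H \<subseteq> ?G"
      proof
        fix z assume z: "z \<in> ?H"
        obtain \<eta> A where zA: "z = (\<eta>, A)" by (cases z)
        have "\<eta> \<in> {0..E}" "A \<in> K" using z pos_def_mat_1 by (auto simp: zA)
        moreover have "minimizer (penalized_loss pen S \<eta>) A"
          using z K(2) \<open>A \<in> K\<close> by (auto simp: zA minimizer_def)
        ultimately have "A = h \<eta>"
          using minimizer_penalized_loss_unique[OF S pen] h by auto
        then show "z \<in> ?G" using \<open>\<eta> \<in> {0..E}\<close> by (simp add: zA)
      qed
    qed
    moreover have "closed ?H"
    proof (intro closed_INT ballI continuous_on_closed_Collect_le cont)
      show "continuous_on ({0..E} \<times> K) (\<lambda>z. penalized_loss pen S (fst z) B)" for B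
        unfolding penalized_loss_eq by (intro continuous_intros)
      show "closed ({0..E} \<times> K)" using K(1) by (intro closed_Times compact_imp_closed) auto
    qed
    ultimately have "closed ((\<lambda>\<eta>. (\<eta>, h \<eta>)) ` {0..E})" by simp
    then show ?thesis using hK by (intro continuous_from_closed_graph[OF K(1)]) auto
  qed
  show ?thesis
    unfolding continuous_on_eq_continuous_within
  proof
    fix \<eta> :: real assume \<eta>: "\<eta> \<in> {0..}"
    then have "continuous (at \<eta> within {0..\<eta> + 1}) h"
      using bounded[of "\<eta> + 1"] unfolding continuous_on_eq_continuous_within by auto
    moreover have "at \<eta> within {0..\<eta> + 1} = at \<eta> within {0..}"
      by (rule at_within_nhd[of _ "{..<\<eta> + 1}"]) auto
    ultimately show "continuous (at \<eta> within {0..}) h" by simp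
  qed
qed

theorem lemma2p2:
  fixes pen :: "real^'q^'q \<Rightarrow> real" and x :: "nat \<Rightarrow> real^'q" and n :: nat
  assumes "\<And>\<Sigma>. pos_def \<Sigma> \<Longrightarrow> 0 \<le> pen \<Sigma>"
    and "g_convex pen"
    and "pos_def (sample_cov n x)"
  shows "\<exists>\<Sigma>h :: real \<Rightarrow> real^'q^'q.
    (\<forall>\<eta>\<ge>0.
       pos_def (\<Sigma>h \<eta>) \<and>
       (\<forall>\<Sigma>. critical_point (penalized_loss pen (sample_cov n x) \<eta>) \<Sigma> \<longleftrightarrow> \<Sigma> = \<Sigma>h \<eta>) \<and>
       (\<forall>\<Sigma>. minimizer (penalized_loss pen (sample_cov n x) \<eta>) \<Sigma> \<longleftrightarrow> \<Sigma> = \<Sigma>h \<eta>)) \<and>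
    continuous_on {0..} \<Sigma>h"
proof -
  let ?S = "sample_cov n x"
  let ?L = "penalized_loss pen ?S"
  obtain h where h: "\<And>\<eta>. \<eta> \<ge> 0 \<Longrightarrow> minimizer (?L \<eta>) (h \<eta>)"
    using minimizer_penalized_loss_exists[OF assms(3,2,1)] by metis
  have uniq: "minimizer (?L \<eta>) \<Sigma> \<longleftrightarrow> \<Sigma> = h \<eta>" if "\<eta> \<ge> 0" for \<eta> \<Sigma>
    using minimizer_penalized_loss_unique[OF assms(3,2) that] h[OF that] by blast
  have crit: "critical_point (?L \<eta>) \<Sigma> \<longleftrightarrow> minimizer (?L \<eta>) \<Sigma>" if "\<eta> \<ge> 0" for \<eta> \<Sigma>
    using g_convex_penalized_loss[OF assms(3,2) that]
    by (blast intro: critical_point_imp_minimizer minimizer_imp_critical_point)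
  have "continuous_on {0..} h"
    using minimizer_penalized_loss_continuous[OF assms(3,2,1) h] .
  moreover have "pos_def (h \<eta>)" if "\<eta> \<ge> 0" for \<eta>
    using h[OF that] by (simp add: minimizer_def)
  ultimately show ?thesis using uniq crit by (intro exI[of _ h]) simp
qed

end
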